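(* Let $G$ be a graph with $\alpha(G)=2$ having four cliques $Q_1,Q_2,Q_3,Q_4$ (not necessarily distinct or disjoint) with $Q_1\cup Q_2\cup Q_3\cup Q_4=V(G)$ and $\sum_{i=1}^4|Q_i|\ge |V(G)|+2$. Then every proper inflation $G'$ of $G$ satisfies $\mathrm{had}(G')\ge |V(G')|/2$.
   Context: All graphs are finite and simple. An inflation of a graph $H$ is obtained by choosing integers $c_x\ge 0$ for $x\in V(H)$, replacing each $x$ by a clique $C_x$ of order $c_x$, with every vertex of $C_x$ adjacent to every vertex of $C_y$ ($x\neq y$) if $xy\in E(H)$ and no edges between them otherwise; it is proper if $c_x\ge 1$ for all $x$. (A proper inflation of a graph with $\alpha=2$ again has independence number $2$.) $\mathrm{had}(G)$ is the largest $t$ such that $K_t$ is a minor of $G$. *)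

theory Defs
  imports Complex_Main "HOL-Library.Disjoint_Sets" "Graph_Theory.Graph_Theory"
begin

text \<open>
  The locale \<^locale>\<open>graph\<close> describes finite simple graphs as symmetric, loop-free digraphs
  without parallel arcs; \<open>u \<rightarrow>\<^bsub>G\<^esub> v\<close> is adjacency.
\<close>

definition clique :: "('a, 'b) pre_digraph \<Rightarrow> 'a set \<Rightarrow> bool" where
  "clique G Q \<longleftrightarrow> Q \<subseteq> verts G \<and> pairwise (\<lambda>u v. u \<rightarrow>\<^bsub>G\<^esub> v) Q"

definition independent_set :: "('a, 'b) pre_digraph \<Rightarrow> 'a set \<Rightarrow> bool" where
  "independent_set G S \<longleftrightarrow> S \<subseteq> verts G \<and> pairwise (\<lambda>u v. \<not> u \<rightarrow>\<^bsub>G\<^esub> v) S"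

definition independence_number :: "('a, 'b) pre_digraph \<Rightarrow> nat" where
  "independence_number G = Max (card ` {S. independent_set G S})"

text \<open>
  The vertex and arc types of \<open>G'\<close> are arbitrary, so \<open>G'\<close> ranges over all isomorphic copies of the
  inflation of \<open>H\<close> with clique orders \<open>c\<close>.
\<close>

definition inflation ::
  "('a, 'b) pre_digraph \<Rightarrow> ('a \<Rightarrow> nat) \<Rightarrow> ('c, 'd) pre_digraph \<Rightarrow> bool" where
  "inflation H c G' \<longleftrightarrow>
    (\<exists>C. verts G' = (\<Union>x\<in>verts H. C x) \<and>
         disjoint_family_on C (verts H) \<and>
         (\<forall>x\<in>verts H. finite (C x) \<and> card (C x) = c x \<and> clique G' (C x)) \<and>
         (\<forall>x\<in>verts H. \<forall>y\<in>verts H. x \<noteq> y \<longrightarrow>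
            (\<forall>u\<in>C x. \<forall>v\<in>C y. u \<rightarrow>\<^bsub>G'\<^esub> v \<longleftrightarrow> x \<rightarrow>\<^bsub>H\<^esub> y)))"

definition proper_inflation :: "('a, 'b) pre_digraph \<Rightarrow> ('c, 'd) pre_digraph \<Rightarrow> bool" where
  "proper_inflation H G' \<longleftrightarrow> (\<exists>c. (\<forall>x\<in>verts H. c x \<ge> 1) \<and> inflation H c G')"

text \<open>
  \<open>B x\<close> is the branch set that is contracted to the vertex \<open>x\<close>; it is nonempty, since
  \<^const>\<open>Digraph_Component.connected\<close> excludes the null graph.
\<close>

definition minor :: "('a, 'b) pre_digraph \<Rightarrow> ('c, 'd) pre_digraph \<Rightarrow> bool" where
  "minor H G \<longleftrightarrow>
    (\<exists>B. (\<forall>x\<in>verts H. B x \<subseteq> verts G \<and> Digraph_Component.connected (G \<restriction> B x)) \<and>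
         disjoint_family_on B (verts H) \<and>
         (\<forall>x y. x \<rightarrow>\<^bsub>H\<^esub> y \<longrightarrow> (\<exists>u\<in>B x. \<exists>v\<in>B y. u \<rightarrow>\<^bsub>G\<^esub> v)))"

definition clique_minor_orders :: "('a, 'b) pre_digraph \<Rightarrow> nat set" where
  "clique_minor_orders G =
    {t. \<exists>K :: (nat, nat \<times> nat) pre_digraph. K\<^bsub>t\<^esub> K \<and> minor K G}"

definition had :: "('a, 'b) pre_digraph \<Rightarrow> nat" where
  "had G = Max (clique_minor_orders G)"

text \<open>The maxima above are taken over finite nonempty sets.\<close>

lemma independent_set_card:
  assumes "graph G"
  shows "finite (card ` {S. independent_set G S})" and "0 \<in> card ` {S. independent_set G S}"
proof -
  interpret graph G by fact
  have "{S. independent_set G S} \<subseteq> Pow (verts G)"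
    by (auto simp: independent_set_def)
  then show "finite (card ` {S. independent_set G S})"
    by (meson finite_Pow_iff finite_imageI finite_subset finite_verts)
  have "independent_set G {}" by (simp add: independent_set_def)
  then show "0 \<in> card ` {S. independent_set G S}" by force
qed

lemma clique_minor_orders:
  assumes "graph G"
  shows "finite (clique_minor_orders G)" and "0 \<in> clique_minor_orders G"
proof -
  interpret graph G by fact
  have "t \<le> card (verts G)" if "t \<in> clique_minor_orders G" for t
  proof -
    from that obtain K :: "(nat, nat \<times> nat) pre_digraph" and B where
      K: "K\<^bsub>t\<^esub> K" and
      B: "\<forall>x\<in>verts K. B x \<subseteq> verts G \<and> Digraph_Component.connected (G \<restriction> B x)" and
      d: "disjoint_family_on B (verts K)"
      unfolding clique_minor_orders_def minor_def by auto
    have ne: "B x \<noteq> {}" if "x \<in> verts K" for x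
      using B that by (auto simp: Digraph_Component.connected_def strongly_connected_def)
    define f where "f x = (SOME v. v \<in> B x)" for x
    have f: "f x \<in> B x" if "x \<in> verts K" for x
      using ne[OF that] by (auto simp: f_def some_in_eq)
    have "inj_on f (verts K)"
      using f d by (force simp: inj_on_def disjoint_family_on_def)
    moreover have "f ` verts K \<subseteq> verts G" using f B by blast
    ultimately have "card (verts K) \<le> card (verts G)"
      by (meson card_inj_on_le finite_verts)
    with K show ?thesis by (simp add: complete_digraph_def)
  qed
  then show "finite (clique_minor_orders G)"
    by (meson finite_nat_set_iff_bounded_le)
  let ?K = "with_proj \<lparr>pverts = {} :: nat set, parcs = {}\<rparr>"
  have "K\<^bsub>0\<^esub> ?K" by (simp add: complete_digraph_pair_def)
  moreover have "minor ?K G" by (simp add: minor_def disjoint_family_on_def)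
  ultimately show "0 \<in> clique_minor_orders G"
    unfolding clique_minor_orders_def by blast
qed

end

theory Submission
  imports Defs
begin

text \<open>
  Write \<open>h\<close> for non-adjacency in \<open>G'\<close>; since \<open>\<alpha>(G') \<le> 2\<close> this relation is triangle-free.
  Inflating keeps the excess of the four cliques, so one of their blow-ups gives a clique \<open>Z\<close> of
  order at least \<open>(n + 2) / 4\<close>; take \<open>Z\<close> maximum. After deleting at most one vertex let
  \<open>n = 2t - 1\<close> and \<open>k = t - |Z|\<close>. Call a triple \<^emph>\<open>odd\<close> if it contains an odd number of \<open>h\<close>-edges; by
  triangle-freeness it then has exactly one, so it induces a path in \<open>G'\<close>, and every further vertex is
  adjacent to it. Hence \<open>Z\<close> and \<open>k\<close> disjoint odd triples outside \<open>Z\<close> form a \<open>K\<^sub>t\<close> minor.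

  If two nonempty sets of total size at least \<open>t\<close> are \<open>h\<close>-complete to each other, a \<open>K\<^sub>t\<close> minor is made of
  singletons and edges by Hall's theorem. Otherwise the odd triples are found by induction on \<open>k\<close>: a
  tight \<open>h\<close>-complete pair yields them by Hall's theorem, and without one \<open>k - 1\<close> triples exist
  avoiding a given \<open>h\<close>-edge \<open>xy\<close>. Let \<open>L\<close> be the set of unused vertices and \<open>b \<in> L - {x, y}\<close>. Oddness
  satisfies a four-point parity law, so it is determined by the graph \<open>E\<close> whose edges are the pairs
  forming an odd triple with \<open>b\<close>; each chosen triple contains an edge of \<open>E\<close>, while \<open>E\<close> has a matching of size \<open>k\<close>. An
  alternating path between the two matchings is traversed from an end in \<open>L\<close> to produce the missing triple. If both ends
  lie outside \<open>L\<close>, then the values \<open>h x z\<close> alternate along the path, which contradicts their equality at its ends. The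
  construction is only obstructed by a pentagon of \<open>E\<close>, which forces \<open>n = 9\<close>, excluded by \<open>R(3,4) = 9\<close>, or can be resolved with one
  further triple.
\<close>

section \<open>Hall's theorem and alternating paths\<close>

text \<open>Halmos-Vaughan induction: a nonempty proper subset \<open>T\<close> with exactly
  \<open>card T\<close> neighbours is matched on its own and its neighbours are deleted from the
  rest. If there is none, a single vertex may be matched arbitrarily, because every nonempty proper
  subset has a neighbour to spare.\<close>

lemma hall:
  assumes "finite A" and "\<And>a. a \<in> A \<Longrightarrow> finite (N a)"
    and "\<And>T. T \<subseteq> A \<Longrightarrow> card T \<le> card (\<Union>(N ` T))"
  shows "\<exists>f. inj_on f A \<and> (\<forall>a\<in>A. f a \<in> N a)"
  using assms
proof (induction A arbitrary: N rule: finite_psubset_induct)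
  case (psubset A)
  note IH = psubset.IH and finN = psubset.prems(1) and hallN = psubset.prems(2)
  show ?case
  proof (cases "A = {}")
    case True
    then show ?thesis by simp
  next
    case False
    then obtain a where a: "a \<in> A" by blast
    show ?thesis
    proof (cases "\<exists>T. T \<subset> A \<and> T \<noteq> {} \<and> card (\<Union>(N ` T)) = card T")
      case True
      then obtain T where T: "T \<subset> A" "T \<noteq> {}" "card (\<Union>(N ` T)) = card T" by blast
      have finT: "finite T" using T(1) psubset.hyps by (meson finite_subset psubset_imp_subset)
      obtain f where f: "inj_on f T" "\<forall>a\<in>T. f a \<in> N a"
        using IH[OF T(1), of N] finN hallN T(1) by (meson psubsetD psubset_imp_subset subset_trans)
      define N' where "N' c = N c - \<Union>(N ` T)" for c
      have "\<exists>g. inj_on g (A - T) \<and> (\<forall>a\<in>A - T. g a \<in> N' a)"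
      proof (rule IH)
        show "A - T \<subset> A" using T(1,2) by blast
        show "finite (N' c)" if "c \<in> A - T" for c
          using that finN by (simp add: N'_def)
        fix U assume U: "U \<subseteq> A - T"
        have finU': "finite U" using U psubset.hyps by (meson Diff_subset finite_subset)
        have "card U + card T = card (U \<union> T)"
          using U finT finU' by (subst card_Un_disjoint) auto
        also have "\<dots> \<le> card (\<Union>(N ` (U \<union> T)))"
          using U T(1) by (intro hallN) blast
        also have "\<Union>(N ` (U \<union> T)) = \<Union>(N' ` U) \<union> \<Union>(N ` T)"
          by (auto simp: N'_def)
        also have "card \<dots> \<le> card (\<Union>(N' ` U)) + card (\<Union>(N ` T))"
          by (rule card_Un_le)
        finally show "card U \<le> card (\<Union>(N' ` U))" using T(3) by simp
      qed
      then obtain g where g: "inj_on g (A - T)" "\<forall>a\<in>A - T. g a \<in> N' a" by blast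
      let ?k = "\<lambda>c. if c \<in> T then f c else g c"
      have "inj_on ?k A"
      proof (rule inj_onI)
        fix c d assume cd: "c \<in> A" "d \<in> A" "?k c = ?k d"
        have "f c' \<noteq> g d'" if "c' \<in> T" "d' \<in> A - T" for c' d'
          using that f(2) g(2) unfolding N'_def by (metis DiffD2 UN_I)
        then show "c = d"
          using cd f(1) g(1) unfolding inj_on_def by (metis DiffI)
      qed
      moreover have "\<forall>c\<in>A. ?k c \<in> N c" using f(2) g(2) by (auto simp: N'_def)
      ultimately show ?thesis by blast
    next
      case False
      have "card {a} \<le> card (\<Union>(N ` {a}))" using a by (intro hallN) simp
      then obtain y where y: "y \<in> N a" by (auto simp: Suc_le_eq card_gt_0_iff)
      define N' where "N' c = N c - {y}" for c
      have "\<exists>g. inj_on g (A - {a}) \<and> (\<forall>c\<in>A - {a}. g c \<in> N' c)"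
      proof (rule IH)
        show "A - {a} \<subset> A" using a by blast
        show "finite (N' c)" if "c \<in> A - {a}" for c
          using that finN by (simp add: N'_def)
        fix U assume U: "U \<subseteq> A - {a}"
        show "card U \<le> card (\<Union>(N' ` U))"
        proof (cases "U = {}")
          case False': False
          have "U \<subset> A" using U a by blast
          then have "card U < card (\<Union>(N ` U))"
            using False False' hallN[of U] by (metis le_neq_implies_less psubset_imp_subset)
          moreover have "\<Union>(N ` U) - {y} = \<Union>(N' ` U)" by (auto simp: N'_def)
          moreover have "finite (\<Union>(N ` U))"
            using \<open>U \<subset> A\<close> finN psubset.hyps by (meson finite_UN finite_subset psubset_imp_subset subsetD)
          ultimately show ?thesis
            using diff_card_le_card_Diff[of "{y}" "\<Union>(N ` U)"] by simp
        qed simp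
      qed
      then obtain g where g: "inj_on g (A - {a})" "\<forall>c\<in>A - {a}. g c \<in> N' c" by blast
      have "inj_on (g(a := y)) A"
      proof (rule inj_onI)
        fix c d assume cd: "c \<in> A" "d \<in> A" "(g(a := y)) c = (g(a := y)) d"
        show "c = d"
          using cd g unfolding inj_on_def N'_def fun_upd_def
          by (metis DiffD2 DiffI singletonD singletonI)
      qed
      moreover have "\<forall>c\<in>A. (g(a := y)) c \<in> N c" using g(2) y by (auto simp: N'_def)
      ultimately show ?thesis by blast
    qed
  qed
qed

text \<open>Adding \<open>d\<close> dummy neighbours common to all vertices restores Hall's
  condition; the at most \<open>d\<close> vertices matched to dummies are then discarded.\<close>

lemma hall_deficiency:
  assumes "finite A" and "\<And>a. a \<in> A \<Longrightarrow> finite (N a)"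
    and "\<And>T. T \<subseteq> A \<Longrightarrow> card T \<le> card (\<Union>(N ` T)) + d"
  shows "\<exists>B f. B \<subseteq> A \<and> card A \<le> card B + d \<and> inj_on f B \<and> (\<forall>a\<in>B. f a \<in> N a)"
proof -
  define N' :: "'a \<Rightarrow> ('b + nat) set" where "N' a = Inl ` N a \<union> Inr ` {..<d}" for a
  have "\<exists>f. inj_on f A \<and> (\<forall>a\<in>A. f a \<in> N' a)"
  proof (rule hall)
    fix T assume T: "T \<subseteq> A"
    show "card T \<le> card (\<Union>(N' ` T))"
    proof (cases "T = {}")
      case False
      have fin: "finite (\<Union>(N ` T))"
        using T assms(1,2) by (meson finite_UN finite_subset subsetD)
      have "\<Union>(N' ` T) = Inl ` \<Union>(N ` T) \<union> Inr ` {..<d}" using False by (auto simp: N'_def)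
      also have "card \<dots> = card (\<Union>(N ` T)) + d"
        using fin by (subst card_Un_disjoint) (auto simp: card_image)
      finally show ?thesis using assms(3)[OF T] by simp
    qed simp
  qed (use assms in \<open>auto simp: N'_def\<close>)
  then obtain f where f: "inj_on f A" "\<forall>a\<in>A. f a \<in> N' a" by blast
  define B where "B = {a \<in> A. isl (f a)}"
  have "inj_on f (A - B)" using f(1) by (meson Diff_subset inj_on_subset)
  moreover have "f ` (A - B) \<subseteq> Inr ` {..<d}" using f(2) by (auto simp: B_def N'_def)
  ultimately have "card (A - B) \<le> card (Inr ` {..<d} :: ('b + nat) set)"
    by (intro card_inj_on_le) auto
  also have "\<dots> = d" by (simp add: card_image)
  finally have "card (A - B) \<le> d" .
  moreover have "card (A - B) = card A - card B"
    using assms(1) by (intro card_Diff_subset) (auto simp: B_def)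
  ultimately have "card A \<le> card B + d" by linarith
  moreover have "inj_on (projl \<circ> f) B"
    using f(1) unfolding inj_on_def B_def by (auto intro: sum.expand)
  moreover have "\<forall>a\<in>B. (projl \<circ> f) a \<in> N a" using f(2) by (auto simp: B_def N'_def)
  moreover have "B \<subseteq> A" by (auto simp: B_def)
  ultimately show ?thesis by blast
qed

section \<open>Lists of disjoint triples and augmenting paths\<close>

text \<open>A packing is kept as a list, so that \<open>distinct\<close> of the flattened list
  expresses at once that the triples are disjoint and that each has three different
  vertices.\<close>

fun triple_verts :: "('a \<times> 'a \<times> 'a) list \<Rightarrow> 'a list" where
  "triple_verts [] = []"
| "triple_verts ((x, y, z) # ts) = x # y # z # triple_verts ts"

lemma triple_verts_append [simp]: "triple_verts (ts @ us) = triple_verts ts @ triple_verts us"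
  by (induction ts rule: triple_verts.induct) auto

lemma set_triple_verts: "set (triple_verts ts) = (\<Union>(x, y, z)\<in>set ts. {x, y, z})"
  by (induction ts rule: triple_verts.induct) auto

lemma length_triple_verts: "length (triple_verts ts) = 3 * length ts"
  by (induction ts rule: triple_verts.induct) auto

text \<open>A triple \<open>(u, v, w)\<close> is oriented: \<open>{u, v}\<close> is its matching edge and \<open>w\<close> its third vertex.\<close>

fun edge_of :: "'a \<times> 'a \<times> 'a \<Rightarrow> 'a set" where
  "edge_of (u, v, w) = {u, v}"

text \<open>The walk \<open>x, p\<^sub>1, q\<^sub>1, \<dots>, p\<^sub>m, q\<^sub>m, z\<close> with triples \<open>(p\<^sub>i, q\<^sub>i, w\<^sub>i)\<close>; only the steps outside the triples are
  required to be in \<open>R\<close>.\<close>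

fun alt_path :: "('a \<Rightarrow> 'a \<Rightarrow> bool) \<Rightarrow> 'a \<Rightarrow> ('a \<times> 'a \<times> 'a) list \<Rightarrow> 'a \<Rightarrow> bool" where
  "alt_path R x [] z = R x z"
| "alt_path R x ((p, q, w) # ts) z = (R x p \<and> alt_path R q ts z)"

lemma alt_path_append:
  "alt_path R x (ts @ (p, q, w) # us) z \<longleftrightarrow> alt_path R x ts p \<and> alt_path R q us z"
  by (induction R x ts p rule: alt_path.induct) auto

abbreviation flip :: "'a \<times> 'a \<times> 'a \<Rightarrow> 'a \<times> 'a \<times> 'a" where
  "flip t \<equiv> (case t of (p, q, w) \<Rightarrow> (q, p, w))"

lemma alt_path_rev:
  assumes "\<And>p q. R p q = R q p" and "alt_path R x ts z"
  shows "alt_path R z (rev (map flip ts)) x"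
  using assms(2)
proof (induction ts arbitrary: x rule: triple_verts.induct)
  case (1 x)
  then show ?case using assms(1) by simp
next
  case (2 p q w ts x)
  then have "alt_path R z (rev (map flip ts)) q" "R p x" using assms(1) by auto
  then show ?case by (simp add: alt_path_append)
qed

lemma triple_verts_flip:
  "distinct (triple_verts (rev (map flip ts))) = distinct (triple_verts ts)"
  "set (triple_verts (rev (map flip ts))) = set (triple_verts ts)"
  by (induction ts rule: triple_verts.induct) auto

lemma alt_path_mono:
  assumes "alt_path R x ts z" and "\<And>p q. R p q \<Longrightarrow> S p q"
  shows "alt_path S x ts z"
  using assms(1) by (induction ts arbitrary: x rule: triple_verts.induct) (auto intro: assms(2))

lemma card_Union_pairs:
  assumes "\<And>e. e \<in> N \<Longrightarrow> card e = 2" and "disjoint N"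
  shows "card (\<Union>N) = 2 * card N"
proof -
  have "card (\<Union>N) = sum card N"
  proof (rule card_Union_disjoint)
    show "pairwise disjnt N" using assms(2) by (simp add: disjoint_def disjnt_def pairwise_def)
    show "finite e" if "e \<in> N" for e
      using assms(1)[OF that] by (intro card_ge_0_finite) simp
  qed
  then show ?thesis using assms(1) by simp
qed

text \<open>The disjoint pairs in \<open>N\<close> cover \<open>2 * card N\<close> vertices, the
  matching edges of \<open>T\<close> at most \<open>2 * card T\<close>.\<close>

lemma card_Union_pairs_gt:
  assumes "finite T" and "finite N" and "card T < card N"
    and "\<And>e. e \<in> N \<Longrightarrow> card e = 2" and "disjoint N"
  shows "\<not> \<Union>N \<subseteq> \<Union>(edge_of ` T)"
proof
  have two: "finite (edge_of t)" "card (edge_of t) \<le> 2" for t :: "'a \<times> 'a \<times> 'a"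
    by (cases t; simp add: card_insert_if)+
  assume "\<Union>N \<subseteq> \<Union>(edge_of ` T)"
  then have "card (\<Union>N) \<le> card (\<Union>(edge_of ` T))"
    using assms(1) two(1) by (intro card_mono) auto
  also have "\<dots> \<le> (\<Sum>t\<in>T. card (edge_of t))" by (rule card_UN_le[OF assms(1)])
  also have "\<dots> \<le> (\<Sum>t\<in>T. 2)" by (rule sum_mono) (rule two(2))
  finally have "card (\<Union>N) \<le> 2 * card T" by simp
  then show False using card_Union_pairs[OF assms(4,5)] assms(3) by simp
qed

text \<open>Berge's augmenting path for the matching edges of \<open>T\<close> against
  \<open>N\<close>. Only vertices of matching edges count as covered, so an end of the path may
  still be the third vertex of some triple. The induction deletes an edge of \<open>N\<close> with
  exactly one covered end, together with the triple covering it.\<close>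

lemma augmenting_path:
  fixes T :: "('a \<times> 'a \<times> 'a) set" and N :: "'a set set"
  assumes "finite T" and "finite N" and "card T < card N"
    and "\<And>e. e \<in> N \<Longrightarrow> card e = 2" and "disjoint N"
    and "\<And>u v w. (u, v, w) \<in> T \<Longrightarrow> distinct [u, v, w]"
    and "\<And>u v w u' v' w'. (u, v, w) \<in> T \<Longrightarrow> (u', v', w') \<in> T \<Longrightarrow> (u, v, w) \<noteq> (u', v', w') \<Longrightarrow>
      {u, v, w} \<inter> {u', v', w'} = {}"
  shows "\<exists>x z ts. alt_path (\<lambda>p q. {p, q} \<in> N) x ts z \<and> x \<noteq> z \<and> x \<in> \<Union>N \<and> z \<in> \<Union>N \<and>
    x \<notin> \<Union>(edge_of ` T) \<and> z \<notin> \<Union>(edge_of ` T) \<and> distinct (triple_verts ts) \<and>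
    (\<forall>(p, q, w)\<in>set ts. (p, q, w) \<in> T \<or> (q, p, w) \<in> T)"
  using assms
proof (induction "card T" arbitrary: T N rule: less_induct)
  case less
  note IH = less.hyps
  note fT = less.prems(1) and fN = less.prems(2) and lt = less.prems(3) and two = less.prems(4)
    and disjN = less.prems(5) and disT = less.prems(6) and disjT = less.prems(7)
  let ?V = "\<Union>(edge_of ` T)"
  show ?case
  proof (cases "\<exists>e\<in>N. e \<inter> ?V = {}")
    case True
    then obtain e where e: "e \<in> N" "e \<inter> ?V = {}" by blast
    then obtain x z where "e = {x, z}" "x \<noteq> z" using two by (meson card_2_iff)
    then show ?thesis using e by (intro exI[of _ x] exI[of _ z] exI[of _ "[]"]) auto
  next
    case False
    have "\<not> \<Union>N \<subseteq> ?V" by (rule card_Union_pairs_gt[OF fT fN lt two disjN])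
    then obtain e x where e: "e \<in> N" "x \<in> e" "x \<notin> ?V" by blast
    obtain a c where ac: "e = {a, c}" "a \<noteq> c" using two[OF e(1)] by (meson card_2_iff)
    define p where "p = (if x = a then c else a)"
    have p: "e = {x, p}" "x \<noteq> p" using ac e(2) by (auto simp: p_def)
    have "e \<inter> ?V \<noteq> {}" using False e(1) by simp
    then have "p \<in> ?V" using e(3) p(1) by simp
    then obtain s where s: "s \<in> T" "p \<in> edge_of s" by blast
    obtain u v w where uvw: "s = (u, v, w)" by (cases s)
    then have "p = u \<or> p = v" using s(2) by simp
    then obtain q where t: "(p, q, w) \<in> T \<or> (q, p, w) \<in> T"
      using s(1) uvw by blast
    define t where "t = (if (p, q, w) \<in> T then (p, q, w) else (q, p, w))"
    have tT: "t \<in> T" using t by (auto simp: t_def)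
    have dpqw: "p \<noteq> q" "p \<noteq> w" "q \<noteq> w" using t disT by force+
    have disj_t: "{u, v, w'} \<inter> {p, q, w} = {}" if "(u, v, w') \<in> T - {t}" for u v w'
      using that disjT[of u v w' p q w] disjT[of u v w' q p w] t
      by (auto simp: t_def split: if_splits)
    \<comment> \<open>Without \<open>e\<close> and \<open>t\<close>, the partner \<open>q\<close> of
      \<open>p\<close> is exposed. If the path of the smaller instance ends in \<open>q\<close>, it
      is prolonged through \<open>p\<close> to \<open>x\<close>; if not, its ends stay exposed when
      \<open>t\<close> is restored.\<close>
    let ?N = "N - {e}"
    have "e \<inter> e' = {}" if "e' \<in> ?N" for e'
      using that disjN e(1) unfolding disjoint_def by blast
    then have xN: "x \<notin> \<Union>?N" and pN: "p \<notin> \<Union>?N" using p(1) by blast+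
    have "\<exists>x z ts. alt_path (\<lambda>p q. {p, q} \<in> ?N) x ts z \<and> x \<noteq> z \<and> x \<in> \<Union>?N \<and> z \<in> \<Union>?N \<and>
      x \<notin> \<Union>(edge_of ` (T - {t})) \<and> z \<notin> \<Union>(edge_of ` (T - {t})) \<and> distinct (triple_verts ts) \<and>
      (\<forall>(p, q, w)\<in>set ts. (p, q, w) \<in> T - {t} \<or> (q, p, w) \<in> T - {t})"
    proof (rule IH)
      show "card (T - {t}) < card T" using tT fT by (rule card_Diff1_less[rotated])
      show "card (T - {t}) < card ?N"
        using lt tT e(1) fT fN card_gt_0_iff[of T] by (auto simp: card_Diff_singleton)
      show "disjoint ?N" using disjN by (auto simp: disjoint_def)
      show "finite (T - {t})" "finite ?N" using fT fN by simp_all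
      show "card e' = 2" if "e' \<in> ?N" for e' using that two by blast
      show "distinct [u, v, w]" if "(u, v, w) \<in> T - {t}" for u v w using that disT by blast
      show "{u, v, w} \<inter> {u', v', w'} = {}"
        if "(u, v, w) \<in> T - {t}" "(u', v', w') \<in> T - {t}" "(u, v, w) \<noteq> (u', v', w')" for u v w u' v' w'
        using that disjT by blast
    qed
    then obtain x' z' ts where P: "alt_path (\<lambda>p q. {p, q} \<in> ?N) x' ts z'" "x' \<noteq> z'" "x' \<in> \<Union>?N" "z' \<in> \<Union>?N"
      "x' \<notin> \<Union>(edge_of ` (T - {t}))" "z' \<notin> \<Union>(edge_of ` (T - {t}))" "distinct (triple_verts ts)"
      "\<forall>(p, q, w)\<in>set ts. (p, q, w) \<in> T - {t} \<or> (q, p, w) \<in> T - {t}" by blast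
    have V: "a \<in> ?V \<longleftrightarrow> a \<in> {p, q} \<or> a \<in> \<Union>(edge_of ` (T - {t}))" for a
    proof -
      have "T = insert t (T - {t})" using tT by blast
      moreover have "edge_of t = {p, q}" by (auto simp: t_def)
      ultimately show ?thesis by (metis UN_insert Un_iff)
    qed
    have sub: "alt_path (\<lambda>p q. {p, q} \<in> N) a us c" if "alt_path (\<lambda>p q. {p, q} \<in> ?N) a us c" for a c us
      using that by (rule alt_path_mono) blast
    have ext: ?thesis if Q: "alt_path (\<lambda>p q. {p, q} \<in> ?N) q us c" "q \<noteq> c" "c \<in> \<Union>?N"
      "c \<notin> \<Union>(edge_of ` (T - {t}))" "distinct (triple_verts us)"
      "\<forall>(p, q, w)\<in>set us. (p, q, w) \<in> T - {t} \<or> (q, p, w) \<in> T - {t}" for us c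
    proof -
      have notin: "a \<notin> set (triple_verts us)" if "a \<in> {p, q, w}" for a
      proof
        assume "a \<in> set (triple_verts us)"
        then obtain u v w' where "(u, v, w') \<in> set us" "a \<in> {u, v, w'}"
          by (auto simp: set_triple_verts)
        then show False using Q(6) that disj_t[of u v w'] disj_t[of v u w'] by blast
      qed
      have "c \<noteq> p" "c \<noteq> x" using Q(3) pN xN by auto
      then show ?thesis
        using sub[OF Q(1)] Q e p V[of c] t notin dpqw
        by (intro exI[of _ x] exI[of _ c] exI[of _ "(p, q, w) # us"]) auto
    qed
    consider "x' = q" | "z' = q" | "x' \<noteq> q" "z' \<noteq> q" by blast
    then show ?thesis
    proof cases
      case 1
      then show ?thesis using ext[of ts z'] P by blast
    next
      case 2
      have "alt_path (\<lambda>p q. {p, q} \<in> ?N) z' (rev (map flip ts)) x'"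
        by (rule alt_path_rev[OF _ P(1)]) (simp add: insert_commute)
      moreover have "\<forall>(p, q, w)\<in>set (rev (map flip ts)). (p, q, w) \<in> T - {t} \<or> (q, p, w) \<in> T - {t}"
        using P(8) by auto
      ultimately show ?thesis
        using ext[of "rev (map flip ts)" x'] P 2 by (simp add: triple_verts_flip)
    next
      case 3
      have "x' \<noteq> p" "z' \<noteq> p" using P(3,4) pN by auto
      then have "x' \<notin> ?V" "z' \<notin> ?V" using 3 P(5,6) V by auto
      moreover have "\<forall>(p, q, w)\<in>set ts. (p, q, w) \<in> T \<or> (q, p, w) \<in> T" using P(8) by blast
      ultimately show ?thesis using P(1-4,7) sub[OF P(1)] by blast
    qed
  qed
qed

text \<open>A path may run through a triple of \<open>us\<close> in flipped orientation. The list
  \<open>vs\<close> collects the triples off the path, so that \<open>ts @ vs\<close> is the same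
  packing, oriented as the path demands.\<close>

lemma complementary_triples:
  assumes "distinct (triple_verts us)" and "distinct (triple_verts ts)"
    and "\<forall>(p, q, w)\<in>set ts. (p, q, w) \<in> set us \<or> (q, p, w) \<in> set us"
  shows "\<exists>vs. set vs \<subseteq> set us \<and> length ts + length vs = length us \<and>
    distinct (triple_verts (ts @ vs)) \<and> set (triple_verts (ts @ vs)) = set (triple_verts us) \<and>
    (\<forall>(p, q, w)\<in>set us. (p, q, w) \<in> set (ts @ vs) \<or> (q, p, w) \<in> set ts)"
  using assms(2,3)
proof (induction ts rule: triple_verts.induct)
  case 1
  then show ?case using assms(1) by (intro exI[of _ us]) auto
next
  case (2 p q w ts)
  obtain vs where vs: "set vs \<subseteq> set us" "length ts + length vs = length us"
    "distinct (triple_verts (ts @ vs))" "set (triple_verts (ts @ vs)) = set (triple_verts us)"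
    "\<forall>(p, q, w)\<in>set us. (p, q, w) \<in> set (ts @ vs) \<or> (q, p, w) \<in> set ts"
  proof -
    have "distinct (triple_verts ts)" "\<forall>(p, q, w)\<in>set ts. (p, q, w) \<in> set us \<or> (q, p, w) \<in> set us"
      using "2.prems" by simp_all
    from "2.IH"[OF this] that show ?thesis by blast
  qed
  \<comment> \<open>A third vertex identifies its triple, so \<open>(p', q', w)\<close> has not been
    consumed by \<open>ts\<close> and is still in \<open>vs\<close>.\<close>
  have "w \<notin> set (triple_verts ts)" using "2.prems"(1) by simp
  then have w: "(a, c, w) \<notin> set ts" for a c by (force simp: set_triple_verts)
  have "(p, q, w) \<in> set us \<or> (q, p, w) \<in> set us" using "2.prems"(2) by simp
  then obtain p' q' where t: "(p', q', w) \<in> set us" "(p', q') = (p, q) \<or> (p', q') = (q, p)"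
    by blast
  then have "(p', q', w) \<in> set vs" using vs(5) w by auto
  then obtain vs1 vs2 where split: "vs = vs1 @ (p', q', w) # vs2" by (meson split_list)
  show ?case
  proof (intro exI[of _ "vs1 @ vs2"] conjI)
    show "set (vs1 @ vs2) \<subseteq> set us" using vs(1) split by auto
    show "length ((p, q, w) # ts) + length (vs1 @ vs2) = length us" using vs(2) split by auto
    show "distinct (triple_verts (((p, q, w) # ts) @ vs1 @ vs2))" using vs(3) split t(2) by auto
    show "set (triple_verts (((p, q, w) # ts) @ vs1 @ vs2)) = set (triple_verts us)"
      using vs(4) split t(2) by auto
    show "\<forall>(a, c, d)\<in>set us. (a, c, d) \<in> set (((p, q, w) # ts) @ vs1 @ vs2) \<or> (c, a, d) \<in> set ((p, q, w) # ts)"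
      using vs(5) split t(2) by auto
  qed
qed

lemma distinct_triple_verts_map:
  assumes "distinct xs" "inj_on f (set xs)" "inj_on g (set xs)"
    "f ` set xs \<inter> set xs = {}" "g ` set xs \<inter> set xs = {}" "f ` set xs \<inter> g ` set xs = {}"
  shows "distinct (triple_verts (map (\<lambda>x. (f x, x, g x)) xs))"
  using assms
proof (induction xs)
  case (Cons x xs)
  have "set (triple_verts (map (\<lambda>x. (f x, x, g x)) xs)) = f ` set xs \<union> set xs \<union> g ` set xs"
    by (auto simp: set_triple_verts)
  moreover have "distinct (triple_verts (map (\<lambda>x. (f x, x, g x)) xs))"
    using Cons.prems by (intro Cons.IH) auto
  ultimately show ?case using Cons.prems by (auto simp: inj_on_def)
qed simp

lemma pairs_of_injection:
  assumes "inj_on f B" and "f ` B \<inter> B = {}"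
  shows "disjoint ((\<lambda>a. {a, f a}) ` B)" and "card ((\<lambda>a. {a, f a}) ` B) = card B"
proof -
  have disj: "{a, f a} \<inter> {c, f c} = {}" if "a \<in> B" "c \<in> B" "a \<noteq> c" for a c
    using that assms unfolding inj_on_def by auto
  have inj: "inj_on (\<lambda>a. {a, f a}) B"
  proof (rule inj_onI, rule ccontr)
    fix a c assume ac: "a \<in> B" "c \<in> B" "{a, f a} = {c, f c}" "a \<noteq> c"
    then show False using disj[OF ac(1,2,4)] by simp
  qed
  show "disjoint ((\<lambda>a. {a, f a}) ` B)"
    unfolding disjoint_def
  proof (intro ballI impI)
    fix e e' assume "e \<in> (\<lambda>a. {a, f a}) ` B" "e' \<in> (\<lambda>a. {a, f a}) ` B" "e \<noteq> e'"
    then obtain a c where "a \<in> B" "c \<in> B" "e = {a, f a}" "e' = {c, f c}" "a \<noteq> c" by blast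
    then show "e \<inter> e' = {}" using disj[of a c] by simp
  qed
  show "card ((\<lambda>a. {a, f a}) ` B) = card B" by (rule card_image[OF inj])
qed

lemma in_triple_verts:
  "(u, v, w) \<in> set us \<Longrightarrow> u \<in> set (triple_verts us) \<and> v \<in> set (triple_verts us) \<and> w \<in> set (triple_verts us)"
  by (induction us rule: triple_verts.induct) auto

lemma triple_verts_disjoint:
  assumes "distinct (triple_verts us)" "(u, v, w) \<in> set us" "(u', v', w') \<in> set us"
    "(u, v, w) \<noteq> (u', v', w')"
  shows "{u, v, w} \<inter> {u', v', w'} = {}"
proof -
  obtain us1 us2 where us: "us = us1 @ (u, v, w) # us2" using assms(2) by (meson split_list)
  then have "(u', v', w') \<in> set (us1 @ us2)" using assms(3,4) by auto
  then have "{u', v', w'} \<subseteq> set (triple_verts (us1 @ us2))" using in_triple_verts by (metis empty_subsetI insert_subset)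
  moreover have "{u, v, w} \<inter> set (triple_verts (us1 @ us2)) = {}" using assms(1) us by auto
  ultimately show ?thesis by blast
qed

lemma triple_verts_distinct_triple:
  assumes "distinct (triple_verts us)" "(u, v, w) \<in> set us"
  shows "distinct [u, v, w]"
proof -
  obtain us1 us2 where us: "us = us1 @ (u, v, w) # us2" using assms(2) by (meson split_list)
  then show ?thesis using assms(1) by auto
qed

text \<open>The vertex \<open>c\<close> occurs at most once, so at most one triple changes and the
  fresh \<open>l\<close> enters at most once.\<close>

lemma replace_third:
  assumes "distinct (triple_verts ts)" "l \<notin> set (triple_verts ts)"
  shows "distinct (triple_verts (map (\<lambda>(p, q, w). (p, q, if w = c then l else w)) ts))"
  using assms
proof (induction ts rule: triple_verts.induct)
  case (2 p q w ts)
  let ?r = "\<lambda>(p, q, w). (p, q, if w = c then l else w)"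
  have IH: "distinct (triple_verts (map ?r ts))" using 2 by simp
  have sub: "set (triple_verts (map ?r ts)) \<subseteq> insert l (set (triple_verts ts))"
    by (auto simp: set_triple_verts split: if_splits)
  show ?case
  proof (cases "w = c")
    case True
    then have "c \<notin> set (triple_verts ts)" using "2.prems"(1) by simp
    then have "map ?r ts = ts" using in_triple_verts by (intro map_idI) fastforce
    then show ?thesis using True "2.prems" by auto
  next
    case False
    then show ?thesis using IH sub "2.prems" by auto
  qed
qed simp

lemma alt_path_third: "alt_path R x (map (\<lambda>(p, q, w). (p, q, f w)) ts) z = alt_path R x ts z"
  by (induction R x ts z rule: alt_path.induct) auto

text \<open>Passes from lists to families of sets. The blocks are nonempty and disjoint, so none is
  lost when the list becomes a set.\<close>

lemma blocks_of_triples: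
  assumes "distinct (triple_verts ts)"
  shows "disjoint ((\<lambda>(x, y, z). {x, y, z}) ` set ts)"
    and "card ((\<lambda>(x, y, z). {x, y, z}) ` set ts) = length ts"
    and "\<Union>((\<lambda>(x, y, z). {x, y, z}) ` set ts) = set (triple_verts ts)"
proof -
  let ?f = "\<lambda>(x, y, z). {x, y, z}"
  have "disjoint (?f ` set ts) \<and> card (?f ` set ts) = length ts \<and> \<Union>(?f ` set ts) = set (triple_verts ts)"
    using assms
  proof (induction ts rule: triple_verts.induct)
    case (2 x y z ts)
    have IH: "disjoint (?f ` set ts)" "card (?f ` set ts) = length ts" "\<Union>(?f ` set ts) = set (triple_verts ts)"
      using 2 by simp_all
    have new: "{x, y, z} \<inter> e = {}" if "e \<in> ?f ` set ts" for e
    proof -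
      have "e \<subseteq> set (triple_verts ts)" unfolding IH(3)[symmetric] using that by (rule Union_upper)
      then show ?thesis using "2.prems" by auto
    qed
    have "{x, y, z} \<notin> ?f ` set ts"
    proof
      assume "{x, y, z} \<in> ?f ` set ts"
      from new[OF this] show False by simp
    qed
    moreover have "disjoint (insert {x, y, z} (?f ` set ts))"
      using IH(1) new unfolding disjoint_def by (simp add: Int_commute)
    ultimately show ?case using IH by simp
  qed (simp add: disjoint_def)
  then show "disjoint (?f ` set ts)" "card (?f ` set ts) = length ts" "\<Union>(?f ` set ts) = set (triple_verts ts)"
    by blast+
qed

section \<open>Packing odd triples in triangle-free graphs\<close>

locale triangle_free =
  fixes h :: "'a \<Rightarrow> 'a \<Rightarrow> bool"
  assumes sym: "h x y \<Longrightarrow> h y x"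
    and irrefl: "\<not> h x x"
    and no_triangle: "h x y \<Longrightarrow> h y z \<Longrightarrow> \<not> h x z"
begin

lemma h_comm: "h x y = h y x"
  using sym by blast

text \<open>Oddness is written as a parity, which makes \<open>four_point\<close> a propositional
  identity; triangle-freeness turns it into exactly one \<open>h\<close>-edge.\<close>

definition odd3 :: "'a \<Rightarrow> 'a \<Rightarrow> 'a \<Rightarrow> bool" where
  "odd3 x y z \<longleftrightarrow> ((h x y \<noteq> h y z) \<noteq> h x z)"

lemma odd3_comm: "odd3 x y z = odd3 x z y"
  unfolding odd3_def using h_comm by metis

lemma odd3_rot: "odd3 x y z = odd3 y z x"
  unfolding odd3_def using h_comm by metis

lemma odd3_same [simp]: "\<not> odd3 x x y" "\<not> odd3 x y x" "\<not> odd3 y x x"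
  unfolding odd3_def using h_comm irrefl by metis+

text \<open>Every pair of vertices lies in two of the four triples of a 4-set, so the number of odd ones is even.\<close>

lemma four_point: "odd3 p q r \<longleftrightarrow> ((odd3 b p q \<noteq> odd3 b q r) \<noteq> odd3 b p r)"
  unfolding odd3_def by auto

lemma odd3_distinct: "odd3 x y z \<Longrightarrow> x \<noteq> y \<and> y \<noteq> z \<and> x \<noteq> z"
  by auto

section \<open>Packings of odd triples\<close>

definition packs :: "nat \<Rightarrow> 'a set \<Rightarrow> bool" where
  "packs n U \<longleftrightarrow> (\<exists>ts. length ts = n \<and> distinct (triple_verts ts) \<and>
     set (triple_verts ts) \<subseteq> U \<and> (\<forall>(x, y, z)\<in>set ts. odd3 x y z))"

lemma packsI:
  assumes "length ts = n" "distinct (triple_verts ts)" "set (triple_verts ts) \<subseteq> U"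
    "\<forall>(x, y, z)\<in>set ts. odd3 x y z"
  shows "packs n U"
  using assms unfolding packs_def by blast

lemma packs_mono: "packs n U \<Longrightarrow> U \<subseteq> W \<Longrightarrow> packs n W"
  unfolding packs_def by blast

text \<open>Moving along the path, either two odd triples on \<open>x, b, l, p, q, w\<close> can be split off at once, or
  \<open>(p, q, w)\<close> is exchanged for \<open>(x, p, w)\<close> and the walk continues from \<open>q\<close>.\<close>

lemma walk:
  assumes "alt_path (odd3 b) x ts z"
    and "distinct (x # b # l # triple_verts ts @ triple_verts us)"
    and "\<forall>(p, q, w)\<in>set ts. odd3 b p q \<and> odd3 p q w \<and> \<not> odd3 b w l \<and> (odd3 b p w \<longrightarrow> \<not> odd3 b p l)"
    and "\<forall>(p, q, w)\<in>set us. odd3 b p q \<and> odd3 p q w \<and> \<not> odd3 b w l"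
    and "z \<notin> set (x # b # triple_verts ts @ triple_verts us) \<or> (\<exists>p q. (p, q, z) \<in> set (ts @ us))"
  shows "packs (Suc (length ts + length us)) (set (z # x # b # l # triple_verts ts @ triple_verts us))"
  using assms
proof (induction ts arbitrary: x us rule: triple_verts.induct)
  case (1 x us)
  have us: "\<forall>(p, q, w)\<in>set us. odd3 p q w" using "1.prems"(4) by auto
  have xz: "odd3 b x z" using "1.prems"(1) by simp
  show ?case
  proof (cases "odd3 b x l")
    case True
    then show ?thesis
      using us "1.prems"(2) by (intro packsI[of "(b, x, l) # us"]) auto
  next
    case xl: False
    show ?thesis
    proof (cases "z \<in> set (x # b # triple_verts us)")
      \<comment> \<open>Here \<open>z\<close> is the third vertex of a triple of the packing. There
        \<open>b\<close> takes its place, which frees \<open>z\<close> for a triple with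
        \<open>x\<close> and \<open>l\<close>.\<close>
      case True
      then obtain p q where pq: "(p, q, z) \<in> set us" using "1.prems"(5) by auto
      then obtain us1 us2 where split: "us = us1 @ (p, q, z) # us2" by (meson split_list)
      have "odd3 b p q" "\<not> odd3 b z l" using pq "1.prems"(4) by auto
      moreover have "odd3 x z l"
        using xz xl \<open>\<not> odd3 b z l\<close> four_point[of x z l b] by simp
      moreover have "odd3 p q b" using \<open>odd3 b p q\<close> odd3_rot by blast
      ultimately show ?thesis
        using us "1.prems"(2) unfolding split
        by (intro packsI[of "(x, z, l) # (p, q, b) # us1 @ us2"]) auto
    next
      case False
      then show ?thesis
        using us xz "1.prems"(2) by (intro packsI[of "(b, x, z) # us"]) auto
    qed
  qed
next
  case (2 p q w ts x us)
  have us: "\<forall>(p, q, w)\<in>set us. odd3 p q w" using "2.prems"(4) by auto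
  have ts: "\<forall>(p, q, w)\<in>set ts. odd3 p q w" using "2.prems"(3) by auto
  have xp: "odd3 b x p" and tail: "alt_path (odd3 b) q ts z" using "2.prems"(1) by simp_all
  have pq: "odd3 b p q" and pqw: "odd3 p q w" and wl: "\<not> odd3 b w l"
    and tri: "odd3 b p w \<longrightarrow> \<not> odd3 b p l" using "2.prems"(3) by auto
  consider "odd3 b x l" | "\<not> odd3 b x l" "odd3 b x w" | "\<not> odd3 b x l" "\<not> odd3 b x w" "odd3 b p w"
    | "\<not> odd3 b x l" "\<not> odd3 b x w" "\<not> odd3 b p w" by blast
  then show ?case
  proof cases
    case 1
    then show ?thesis
      using us ts pqw "2.prems"(2) by (intro packsI[of "(b, x, l) # (p, q, w) # ts @ us"]) auto
  next
    case 2
    then have "odd3 x w l" using wl four_point[of x w l b] by simp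
    moreover have "odd3 p q b" using pq odd3_rot by blast
    ultimately show ?thesis
      using us ts "2.prems"(2) by (intro packsI[of "(x, w, l) # (p, q, b) # ts @ us"]) auto
  next
    \<comment> \<open>The triple \<open>p q w\<close> is now a triangle of the graph given by
      \<open>odd3 b\<close>, so \<open>q w\<close> is an edge too: \<open>b\<close> replaces
      \<open>p\<close>, which joins \<open>x\<close> and \<open>l\<close>.\<close>
    case 3
    then have "odd3 x p l" using xp tri four_point[of x p l b] by simp
    moreover have "odd3 q w b"
      using pqw pq 3 four_point[of p q w b] odd3_rot by metis
    ultimately show ?thesis
      using us ts "2.prems"(2) by (intro packsI[of "(x, p, l) # (q, w, b) # ts @ us"]) auto
  next
    case 4
    then have xpw: "odd3 x p w" using xp four_point[of x p w b] by simp
    have "packs (Suc (length ts + length ((x, p, w) # us)))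
        (set (z # q # b # l # triple_verts ts @ triple_verts ((x, p, w) # us)))"
    proof (rule "2.IH")
      show "alt_path (odd3 b) q ts z" by (fact tail)
      show "distinct (q # b # l # triple_verts ts @ triple_verts ((x, p, w) # us))"
        using "2.prems"(2) by auto
      show "\<forall>(p, q, w)\<in>set ts. odd3 b p q \<and> odd3 p q w \<and> \<not> odd3 b w l \<and> (odd3 b p w \<longrightarrow> \<not> odd3 b p l)"
        using "2.prems"(3) by auto
      show "\<forall>(p, q, w)\<in>set ((x, p, w) # us). odd3 b p q \<and> odd3 p q w \<and> \<not> odd3 b w l"
        using "2.prems"(4) xp xpw wl by auto
      show "z \<notin> set (q # b # triple_verts ts @ triple_verts ((x, p, w) # us)) \<or>
          (\<exists>p' q'. (p', q', z) \<in> set (ts @ (x, p, w) # us))"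
        using "2.prems"(5) by auto
    qed
    then have "packs (Suc (length ((p, q, w) # ts) + length us))
        (set (z # q # b # l # triple_verts ts @ triple_verts ((x, p, w) # us)))" by simp
    then show ?thesis by (rule packs_mono) auto
  qed
qed

section \<open>Small configurations around an odd triple\<close>

lemma packs2I:
  assumes "odd3 x y z" "odd3 x' y' z'" "distinct [x, y, z, x', y', z']" "{x, y, z, x', y', z'} \<subseteq> U"
  shows "packs 2 U"
  using assms by (intro packsI[of "[(x, y, z), (x', y', z')]"]) auto

lemma packs3I:
  assumes "odd3 x y z" "odd3 x' y' z'" "odd3 x'' y'' z''"
    "distinct [x, y, z, x', y', z', x'', y'', z'']" "{x, y, z, x', y', z', x'', y'', z''} \<subseteq> U"
  shows "packs 3 U"
  using assms by (intro packsI[of "[(x, y, z), (x', y', z'), (x'', y'', z'')]"]) auto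

text \<open>Both conditions on \<open>p\<close> and \<open>q\<close> say that \<open>h y\<close> is complementary to \<open>h x\<close> there.\<close>

lemma type_flip:
  assumes "h x y" "\<not> odd3 x y p" "\<not> odd3 x y q" "odd3 x p q"
  shows "h x p \<noteq> h x q"
proof
  assume eq: "h x p = h x q"
  have "h p q" using assms(4) eq by (auto simp: odd3_def)
  moreover have "h y p = (\<not> h x p)" "h y q = (\<not> h x q)" using assms(1-3) by (auto simp: odd3_def)
  ultimately show False using eq no_triangle[of x p q] no_triangle[of y p q] by auto
qed

text \<open>An induced 5-cycle, in the given order, of the graph whose edges are the pairs
  \<open>p q\<close> with \<open>odd3 b p q\<close>. In the comments below, edges and seeing refer
  to this graph unless \<open>h\<close> is named.\<close>

definition pentagon :: "'a \<Rightarrow> 'a \<Rightarrow> 'a \<Rightarrow> 'a \<Rightarrow> 'a \<Rightarrow> 'a \<Rightarrow> bool" where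
  "pentagon b a1 a2 a3 a4 a5 \<longleftrightarrow>
    odd3 b a1 a2 \<and> odd3 b a2 a3 \<and> odd3 b a3 a4 \<and> odd3 b a4 a5 \<and> odd3 b a5 a1 \<and>
    \<not> odd3 b a1 a3 \<and> \<not> odd3 b a2 a4 \<and> \<not> odd3 b a3 a5 \<and> \<not> odd3 b a4 a1 \<and> \<not> odd3 b a5 a2"

lemma pentagon_rot: "pentagon b a1 a2 a3 a4 a5 \<Longrightarrow> pentagon b a2 a3 a4 a5 a1"
  unfolding pentagon_def by auto

text \<open>As no two disjoint odd triples fit into the triple and \<open>L\<close>, one edge from
  \<open>w\<close> into \<open>L\<close> forces the rest: \<open>w\<close> sees all of
  \<open>L\<close> except \<open>b\<close>, each of these vertices sees exactly one of
  \<open>u\<close> and \<open>v\<close>, and \<open>x\<close> and \<open>y\<close> see different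
  ones. A further vertex of \<open>L\<close> would have to repeat the choice of \<open>x\<close> or
  \<open>y\<close>.\<close>

lemma third_adjacent:
  assumes dist: "distinct [u, v, w]" and disj: "{u, v, w} \<inter> L = {}"
    and uvw: "odd3 u v w" and uv: "odd3 b u v"
    and bxy: "b \<in> L" "x \<in> L" "y \<in> L" "distinct [b, x, y]" "h x y"
    and L: "\<And>p q r. p \<in> L \<Longrightarrow> q \<in> L \<Longrightarrow> r \<in> L \<Longrightarrow> \<not> odd3 p q r"
    and l: "l \<in> L" "odd3 b l w"
    and nopack: "\<not> packs 2 ({u, v, w} \<union> L)"
  shows "L = {b, x, y} \<and> (pentagon b u v y w x \<or> pentagon b v u y w x)"
proof -
  note comm = odd3_comm[of b]
  define U where "U = {u, v, w} \<union> L"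
  have U: "u \<in> U" "v \<in> U" "w \<in> U" and LU: "m \<in> U" if "m \<in> L" for m
    using that bxy(1) by (auto simp: U_def)
  note U = U[OF bxy(1)]
  have no2: False if "odd3 c d e" "odd3 c' d' e'" "distinct [c, d, e, c', d', e']"
    "c \<in> U" "d \<in> U" "e \<in> U" "c' \<in> U" "d' \<in> U" "e' \<in> U" for c d e c' d' e'
    using packs2I[OF that(1-3), of U] that(4-9) nopack by (simp add: U_def)
  have neq: "x \<noteq> b" "y \<noteq> b" "b \<noteq> x" "b \<noteq> y" "x \<noteq> y" "y \<noteq> x" using bxy(4) by auto
  have ne: "m \<noteq> u" "m \<noteq> v" "m \<noteq> w" if "m \<in> L" for m using that disj by auto
  have Lb: "\<not> odd3 b p q" if "p \<in> L" "q \<in> L" for p q using L bxy(1) that by blast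
  have w: "odd3 b m w" if m: "m \<in> L" "m \<noteq> b" for m
  proof (rule ccontr)
    assume a: "\<not> odd3 b m w"
    have "odd3 w l m" using a l Lb[OF l(1) m(1)] by (simp add: four_point[of w l m b] comm)
    moreover have "odd3 u v b" using uv odd3_rot by blast
    moreover have "l \<noteq> m" "l \<noteq> b" using a l by auto
    ultimately show False using no2[of w l m u v b] dist ne[OF l(1)] ne[OF m(1)] ne[OF bxy(1)]
      m(2) U LU[OF l(1)] LU[OF m(1)] LU[OF bxy(1)] by auto
  qed
  have uvm: "odd3 b m u \<noteq> odd3 b m v" if m: "m \<in> L" "m \<noteq> b" for m
  proof
    assume a: "odd3 b m u = odd3 b m v"
    have "odd3 u v m" using a uv by (simp add: four_point[of u v m b] comm)
    moreover define l' where "l' = (if m = x then y else x)"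
    have l': "l' \<in> L" "l' \<noteq> m" "l' \<noteq> b" using bxy(2,3) neq by (auto simp: l'_def)
    moreover have "odd3 b l' w" using w l' by blast
    ultimately show False
      using no2[of u v m b l' w] dist ne[OF l'(1)] ne[OF m(1)] ne[OF bxy(1)] m(2)
      U LU[OF l'(1)] LU[OF m(1)] LU[OF bxy(1)] by auto
  qed
  have uw_vw: "odd3 b u w = odd3 b v w" using uvw uv by (simp add: four_point[of u v w b] comm)
  \<comment> \<open>If \<open>u w\<close> were no edge, \<open>{b, m, p}\<close> and
    \<open>{w, q, n}\<close> would be two disjoint odd triples.\<close>
  have same: "odd3 b u w" if pq: "(p, q) = (u, v) \<or> (p, q) = (v, u)"
    and m: "m \<in> L" "n \<in> L" "m \<noteq> b" "n \<noteq> b" "m \<noteq> n" "odd3 b m p" "odd3 b n p" for p q m n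
  proof (rule ccontr)
    assume a: "\<not> odd3 b u w"
    have "\<not> odd3 b q w" using a uw_vw pq by auto
    moreover have "\<not> odd3 b n q" using uvm[OF m(2,4)] m(7) pq by auto
    ultimately have "odd3 w q n" using w[OF m(2,4)] by (simp add: four_point[of w q n b] comm)
    then show False
      using no2[OF m(6), of w q n] m(3-5) pq dist ne[OF m(1)] ne[OF m(2)] ne[OF bxy(1)]
        U LU[OF m(1)] LU[OF m(2)] LU[OF bxy(1)] by auto
  qed
  note wx = w[OF bxy(2) neq(1)] and wy = w[OF bxy(3) neq(2)] and Lxy = Lb[OF bxy(2,3)]
  note ux = uvm[OF bxy(2) neq(1)] and uy = uvm[OF bxy(3) neq(2)]
  have xy: "\<not> odd3 x y b" "\<not> odd3 x y w"
    using L[OF bxy(2,3,1)] wx wy Lxy by (simp_all add: four_point[of x y w b] comm)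
  \<comment> \<open>If \<open>x\<close> and \<open>y\<close> saw the same vertex \<open>s\<close> of
    the pair, then by \<open>type_flip\<close> the values of \<open>h x\<close> at \<open>b\<close>,
    \<open>s\<close> and \<open>w\<close> would be pairwise different, which is impossible for truth
    values.\<close>
  have diff: "odd3 b x p \<noteq> odd3 b y p" if pq: "(p, q) = (u, v) \<or> (p, q) = (v, u)" for p q
  proof
    assume eq: "odd3 b x p = odd3 b y p"
    define s where "s = (if odd3 b x p then p else q)"
    have s: "odd3 b x s" "odd3 b y s" "s = u \<or> s = v"
      using eq ux uy pq by (auto simp: s_def)
    have uw: "odd3 b u w" using s same[of s "if s = u then v else u" x y] bxy(2,3) neq by auto
    then have sw: "odd3 b s w" using s(3) uw_vw by auto
    have "\<not> odd3 x y s" using s Lxy by (simp add: four_point[of x y s b] comm)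
    moreover have "odd3 x s w" using s(1) sw wx by (simp add: four_point[of x s w b] comm)
    moreover have "odd3 x s b" "odd3 x w b" using s(1) wx odd3_rot by blast+
    ultimately show False using type_flip[OF bxy(5)] xy by metis
  qed
  have nt: "\<not> odd3 b u w"
  proof
    assume a: "odd3 b u w"
    define p q where "p = (if odd3 b x u then u else v)" and "q = (if odd3 b x u then v else u)"
    have pq: "(p, q) = (u, v) \<or> (p, q) = (v, u)" "odd3 b x p" "odd3 b y q" "odd3 b q w"
      using ux uy diff[of u v] diff[of v u] a uw_vw by (auto simp: p_def q_def)
    have "odd3 q w y" using pq(3,4) wy by (simp add: four_point[of q w y b] comm)
    then show False using no2[OF pq(2), of q w y] pq(1) dist neq ne[OF bxy(1)] ne[OF bxy(2)] ne[OF bxy(3)]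
      U LU[OF bxy(1)] LU[OF bxy(2)] LU[OF bxy(3)] by auto
  qed
  have "L \<subseteq> {b, x, y}"
  proof
    fix m assume m: "m \<in> L"
    show "m \<in> {b, x, y}"
    proof (rule ccontr)
      assume "m \<notin> {b, x, y}"
      then have m': "m \<noteq> b" "m \<noteq> x" "m \<noteq> y" by auto
      define p q where "p = (if odd3 b m u then u else v)" and "q = (if odd3 b m u then v else u)"
      have pq: "(p, q) = (u, v) \<or> (p, q) = (v, u)" "odd3 b m p"
        using uvm[OF m m'(1)] by (auto simp: p_def q_def)
      define n where "n = (if odd3 b x p then x else y)"
      have "odd3 b n p" "n \<in> L" "n \<noteq> b" "m \<noteq> n"
        using diff[OF pq(1)] bxy(2,3) neq m' by (auto simp: n_def)
      then show False using same[OF pq(1) m, of n] m'(1) pq(2) nt by blast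
    qed
  qed
  then have "L = {b, x, y}" using bxy by auto
  moreover have "pentagon b u v y w x \<or> pentagon b v u y w x"
    using uv nt uw_vw wx wy ux uy diff[of u v] Lxy
    unfolding pentagon_def by (simp add: comm)
  ultimately show ?thesis by blast
qed

text \<open>If three disjoint odd triples do not exist, three explicit packings are excluded in all
  five rotations. The first shows that \<open>r\<close> treats vertices at distance two alike, hence
  the whole pentagon; the second that \<open>p\<close> and \<open>q\<close> differ at each of its
  vertices; the third that adjacency to \<open>p\<close> alternates around it, which an odd cycle
  does not permit.\<close>

lemma nine_points:
  assumes pent: "pentagon b a1 a2 a3 a4 a5" and pq: "odd3 b p q" and pqr: "odd3 p q r"
    and dist: "distinct [a1, a2, a3, a4, a5, b, p, q, r]"
  shows "packs 3 {a1, a2, a3, a4, a5, b, p, q, r}"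
proof (rule ccontr)
  assume nopack: "\<not> ?thesis"
  note comm = odd3_comm[of b]
  define U where "U = {a1, a2, a3, a4, a5, b, p, q, r}"
  have U: "b \<in> U" "p \<in> U" "q \<in> U" "r \<in> U" by (simp_all add: U_def)
  define Y where "Y c1 c2 c3 c4 c5 \<longleftrightarrow> pentagon b c1 c2 c3 c4 c5 \<and>
    distinct [c1, c2, c3, c4, c5, b, p, q, r] \<and> c1 \<in> U \<and> c2 \<in> U \<and> c3 \<in> U \<and> c4 \<in> U \<and> c5 \<in> U"
    for c1 c2 c3 c4 c5
  have rot: "Y c2 c3 c4 c5 c1" if "Y c1 c2 c3 c4 c5" for c1 c2 c3 c4 c5
    using that pentagon_rot[of b c1 c2 c3 c4 c5] unfolding Y_def by auto
  have Y1: "Y a1 a2 a3 a4 a5" using pent dist by (simp add: Y_def U_def)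
  note Y2 = rot[OF Y1]
  note Y3 = rot[OF Y2]
  note Y4 = rot[OF Y3]
  note Y5 = rot[OF Y4]
  have no3: False if "odd3 x y z" "odd3 x' y' z'" "odd3 x'' y'' z''"
    "distinct [x, y, z, x', y', z', x'', y'', z'']"
    "x \<in> U" "y \<in> U" "z \<in> U" "x' \<in> U" "y' \<in> U" "z' \<in> U" "x'' \<in> U" "y'' \<in> U" "z'' \<in> U"
    for x y z x' y' z' x'' y'' z''
    using packs3I[OF that(1-4), of U] that(5-13) nopack by (simp add: U_def)
  have r: "odd3 b r c3 = odd3 b r c5" if Y: "Y c1 c2 c3 c4 c5" for c1 c2 c3 c4 c5
  proof (rule ccontr)
    assume a: "\<not> ?thesis"
    have P: "pentagon b c1 c2 c3 c4 c5" and d: "distinct [c1, c2, c3, c4, c5, b, p, q, r]"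
      and cU: "c1 \<in> U" "c2 \<in> U" "c3 \<in> U" "c4 \<in> U" "c5 \<in> U"
      using Y unfolding Y_def by blast+
    have "odd3 r c3 c5" using a P by (auto simp: four_point[of r c3 c5 b] comm pentagon_def)
    moreover have "odd3 c1 c2 c4" using P by (auto simp: four_point[of c1 c2 c4 b] comm pentagon_def)
    ultimately show False using no3[OF pq, of c1 c2 c4 r c3 c5] d cU U by auto
  qed
  have PQ: "odd3 b p c1 \<noteq> odd3 b q c1" if Y: "Y c1 c2 c3 c4 c5" for c1 c2 c3 c4 c5
  proof
    assume a: "odd3 b p c1 = odd3 b q c1"
    have P: "pentagon b c1 c2 c3 c4 c5" and d: "distinct [c1, c2, c3, c4, c5, b, p, q, r]"
      and cU: "c1 \<in> U" "c2 \<in> U" "c3 \<in> U" "c4 \<in> U" "c5 \<in> U"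
      using Y unfolding Y_def by blast+
    have "odd3 p q c1" using a pq by (simp add: four_point[of p q c1 b] comm)
    moreover have "odd3 b r c2 = odd3 b r c3" using r[OF Y] r[OF rot[OF rot[OF Y]]] by simp
    then have "odd3 c2 c3 r" using P by (simp add: four_point[of c2 c3 r b] comm pentagon_def)
    moreover have "odd3 b c4 c5" using P by (simp add: pentagon_def)
    ultimately show False using no3[of p q c1 c2 c3 r b c4 c5] d cU U by auto
  qed
  have pr: "odd3 b p r = odd3 b q r" using pq pqr by (simp add: four_point[of p q r b] comm)
  have flip: "odd3 b p c3 \<noteq> odd3 b p c4" if Y: "Y c1 c2 c3 c4 c5" for c1 c2 c3 c4 c5
  proof
    assume a: "odd3 b p c3 = odd3 b p c4"
    have P: "pentagon b c1 c2 c3 c4 c5" and d: "distinct [c1, c2, c3, c4, c5, b, p, q, r]"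
      and cU: "c1 \<in> U" "c2 \<in> U" "c3 \<in> U" "c4 \<in> U" "c5 \<in> U"
      using Y unfolding Y_def by blast+
    have a': "odd3 b q c3 = odd3 b q c4"
      using a PQ[OF rot[OF rot[OF Y]]] PQ[OF rot[OF rot[OF rot[OF Y]]]] by blast
    have b12: "odd3 b c1 c2" using P by (simp add: pentagon_def)
    have o: "odd3 c3 c4 p" "odd3 c3 c4 q"
      using a a' P by (simp_all add: four_point[of c3 c4 p b] four_point[of c3 c4 q b] comm pentagon_def)
    have "odd3 b p c5 \<noteq> odd3 b q c5" using PQ[OF rot[OF rot[OF rot[OF rot[OF Y]]]]] .
    then have "odd3 c5 p r \<or> odd3 c5 q r"
      using pr by (auto simp: four_point[of c5 p r b] four_point[of c5 q r b] comm)
    then show False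
      using no3[OF b12 o(1), of c5 q r] no3[OF b12 o(2), of c5 p r] d cU U by auto
  qed
  show False using flip[OF Y1] flip[OF Y2] flip[OF Y3] flip[OF Y4] flip[OF Y5] by blast
qed

section \<open>Stable sets, joined pairs and tight cuts\<close>

text \<open>With \<open>h\<close> as non-adjacency in \<open>G'\<close>, these are the cliques of
  \<open>G'\<close>.\<close>

definition stable :: "'a set \<Rightarrow> bool" where
  "stable Q \<longleftrightarrow> (\<forall>x\<in>Q. \<forall>y\<in>Q. \<not> h x y)"

definition joined :: "'a set \<Rightarrow> 'a set \<Rightarrow> bool" where
  "joined A B \<longleftrightarrow> (\<forall>x\<in>A. \<forall>y\<in>B. h x y)"

lemma joined_sym: "joined A B \<Longrightarrow> joined B A"
  unfolding joined_def using sym by blast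

lemma joined_disjoint: "joined A B \<Longrightarrow> A \<inter> B = {}"
  unfolding joined_def using irrefl by blast

lemma joined_stable: "joined A B \<Longrightarrow> A \<noteq> {} \<Longrightarrow> stable B"
  unfolding joined_def stable_def using no_triangle sym by blast

text \<open>This bound supplies Hall's condition in the lemmas below: a set with too few
  \<open>h\<close>-non-neighbours on the other side is joined to all the rest there, which would be
  an oversized joined pair.\<close>

definition spread :: "nat \<Rightarrow> 'a set \<Rightarrow> bool" where
  "spread k V \<longleftrightarrow> (\<forall>A B. A \<subseteq> V \<longrightarrow> B \<subseteq> V \<longrightarrow> A \<noteq> {} \<longrightarrow> B \<noteq> {} \<longrightarrow> joined A B \<longrightarrow>
     card A + card B + k \<le> card V)"

lemma spreadD:
  "spread k V \<Longrightarrow> A \<subseteq> V \<Longrightarrow> B \<subseteq> V \<Longrightarrow> A \<noteq> {} \<Longrightarrow> B \<noteq> {} \<Longrightarrow> joined A B \<Longrightarrow>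
    card A + card B + k \<le> card V"
  unfolding spread_def by blast

text \<open>Let \<open>B\<close> be the \<open>h\<close>-neighbours of \<open>b\<close> and
  \<open>Y\<close> the other vertices. Edges are the \<open>h\<close>-non-adjacent pairs between
  \<open>B\<close> and \<open>Y\<close> and the \<open>h\<close>-adjacent pairs inside
  \<open>Y\<close>. Hall's theorem with deficiency yields enough edges of the first kind if
  \<open>card B\<close> is at least \<open>k\<close>; otherwise it covers \<open>B\<close>, and a
  maximum matching covering \<open>B\<close> leaves only a stable set.\<close>

lemma exists_odd_matching:
  assumes fin: "finite V" and b: "b \<in> V" and spread: "spread k V"
    and stab: "\<And>Q. Q \<subseteq> V \<Longrightarrow> stable Q \<Longrightarrow> card Q + 2 * k \<le> card V + 1"
  shows "\<exists>N. finite N \<and> k \<le> card N \<and> disjoint N \<and>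
    (\<forall>e\<in>N. \<exists>p\<in>V. \<exists>q\<in>V. e = {p, q} \<and> odd3 b p q)"
proof -
  define B where "B = {z \<in> V. h b z}"
  define Y where "Y = V - insert b B"
  define N where "N a = {q \<in> Y. \<not> h a q}" for a
  have BV: "B \<subseteq> V" "finite B" and YV: "Y \<subseteq> V" "finite Y" using fin by (auto simp: B_def Y_def)
  have bB: "b \<notin> B" using irrefl by (auto simp: B_def)
  have cV: "card V = card B + card Y + 1"
  proof -
    have "card Y = card V - card (insert b B)"
      unfolding Y_def using BV b by (intro card_Diff_subset) auto
    moreover have "card (insert b B) \<le> card V" using BV b fin by (intro card_mono) auto
    ultimately show ?thesis using BV bB by simp
  qed
  have oddBY: "odd3 b a q" if "a \<in> B" "q \<in> N a" for a q
    using that b by (auto simp: odd3_def B_def N_def Y_def)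
  have oddY: "odd3 b p q" if "p \<in> Y" "q \<in> Y" "h p q" for p q
    using that b by (auto simp: odd3_def B_def Y_def)
  \<comment> \<open>The deficiency is a truncated difference: for \<open>card B < k\<close> it is 0
    and all of \<open>B\<close> is matched.\<close>
  have "\<exists>B0 f. B0 \<subseteq> B \<and> card B \<le> card B0 + (card B - k) \<and> inj_on f B0 \<and> (\<forall>a\<in>B0. f a \<in> N a)"
  proof (rule hall_deficiency)
    fix T assume T: "T \<subseteq> B"
    show "card T \<le> card (\<Union> (N ` T)) + (card B - k)"
    proof (cases "T = {}")
      case False
      let ?D = "insert b (Y - \<Union>(N ` T))"
      have NY: "\<Union>(N ` T) \<subseteq> Y" by (auto simp: N_def)
      have "joined T ?D" using T sym by (auto simp: joined_def N_def B_def)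
      moreover have "?D \<subseteq> V" using YV b by blast
      ultimately have "card T + card ?D + k \<le> card V"
        using False T BV by (intro spreadD[OF spread]) auto
      moreover have "card ?D = Suc (card (Y - \<Union>(N ` T)))"
        using YV by (intro card_insert_disjoint) (auto simp: Y_def)
      moreover have "card (Y - \<Union>(N ` T)) = card Y - card (\<Union>(N ` T))"
        using NY YV by (intro card_Diff_subset) (auto intro: finite_subset)
      moreover have "card (\<Union>(N ` T)) \<le> card Y" using NY YV by (intro card_mono) auto
      ultimately show ?thesis using cV by linarith
    qed simp
  qed (use BV YV in \<open>auto simp: N_def\<close>)
  then obtain B0 f where B0: "B0 \<subseteq> B" "card B \<le> card B0 + (card B - k)" "inj_on f B0"
    "\<forall>a\<in>B0. f a \<in> N a" by blast
  let ?M0 = "(\<lambda>a. {a, f a}) ` B0"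
  have fY: "f ` B0 \<subseteq> Y" using B0(4) by (auto simp: N_def)
  have "f ` B0 \<inter> B0 = {}" using fY B0(1) by (auto simp: Y_def)
  note M0 = pairs_of_injection[OF B0(3) this]
  have M0': "\<forall>e\<in>?M0. \<exists>p\<in>V. \<exists>q\<in>V. e = {p, q} \<and> odd3 b p q"
  proof
    fix e assume "e \<in> ?M0"
    then obtain a where a: "a \<in> B0" "e = {a, f a}" by blast
    then have "a \<in> V" "f a \<in> V" "odd3 b a (f a)" using oddBY B0(1,4) BV YV fY by auto
    then show "\<exists>p\<in>V. \<exists>q\<in>V. e = {p, q} \<and> odd3 b p q" using a(2) by blast
  qed
  have finM0: "finite ?M0" using B0(1) BV by (meson finite_imageI finite_subset)
  show ?thesis
  proof (cases "k \<le> card B")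
    case True
    then have "k \<le> card ?M0" using B0(2) M0(2) by linarith
    then show ?thesis using finM0 M0(1) M0' by blast
  next
    case False
    then have "B0 = B" using B0(1,2) BV by (metis add.right_neutral card_seteq diff_is_0_eq nat_le_linear)
    define P where "P = {e. \<exists>p\<in>V. \<exists>q\<in>V. e = {p, q} \<and> odd3 b p q}"
    have PV: "P \<subseteq> Pow (V - {b})" by (auto simp: P_def)
    \<comment> \<open>Covering \<open>B\<close> forces the uncovered vertices other than
      \<open>b\<close> into \<open>Y\<close>, where every \<open>h\<close>-edge is an edge and could
      be added to the matching.\<close>
    define \<M> where "\<M> = {M. disjoint M \<and> M \<subseteq> P \<and> B \<subseteq> \<Union>M}"
    have "?M0 \<subseteq> P" unfolding P_def by (rule subsetI) (use M0' in blast)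
    moreover have "B \<subseteq> \<Union>?M0" using \<open>B0 = B\<close> by blast
    ultimately have "?M0 \<in> \<M>" using M0(1) by (simp add: \<M>_def)
    moreover have "\<M> \<subseteq> Pow P" by (auto simp: \<M>_def)
    then have "finite \<M>" using fin PV by (meson finite_Diff finite_Pow_iff finite_subset)
    ultimately have "Max (card ` \<M>) \<in> card ` \<M>" by (intro Max_in) auto
    then obtain M where M: "M \<in> \<M>" "Max (card ` \<M>) = card M" by blast
    have Mmax: "card M' \<le> card M" if "M' \<in> \<M>" for M'
      unfolding M(2)[symmetric] using that \<open>finite \<M>\<close> by (intro Max_ge) auto
    have Md: "disjoint M" "M \<subseteq> P" "B \<subseteq> \<Union>M" using M(1) by (simp_all add: \<M>_def)
    have MV: "\<Union>M \<subseteq> V - {b}" using Md(2) PV by blast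
    have finM: "finite M" using MV fin by (meson Diff_subset finite_Diff finite_UnionD finite_subset)
    have two: "card e = 2" if e: "e \<in> M" for e
    proof -
      have "e \<in> P" using Md(2) e by blast
      then obtain p q where "e = {p, q}" "odd3 b p q" by (auto simp: P_def)
      then show ?thesis using odd3_distinct[of b p q] by auto
    qed
    define X where "X = V - \<Union>M"
    have "stable X"
      unfolding stable_def
    proof (intro ballI notI)
      fix p q assume pq: "p \<in> X" "q \<in> X" "h p q"
      then have pq': "p \<notin> B" "q \<notin> B" "p \<in> V" "q \<in> V" using Md(3) by (auto simp: X_def)
      have "p \<noteq> b" "q \<noteq> b" using pq pq' sym by (auto simp: B_def)
      then have o: "odd3 b p q" using pq pq' by (intro oddY) (auto simp: Y_def)
      have "disjoint (insert {p, q} M)"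
        using Md(1) pq by (auto simp: disjoint_def X_def)
      then have "insert {p, q} M \<in> \<M>" using Md o pq' by (auto simp: \<M>_def P_def)
      then have "card (insert {p, q} M) \<le> card M" by (rule Mmax)
      moreover have "{p, q} \<notin> M" using pq by (auto simp: X_def)
      ultimately show False using finM by simp
    qed
    \<comment> \<open>As \<open>card X = card V - 2 * card M\<close>, this says
      \<open>2 * k <= 2 * card M + 1\<close>, and parity gives \<open>k <= card M\<close>.\<close>
    then have "card X + 2 * k \<le> card V + 1" by (intro stab) (auto simp: X_def)
    moreover have "card X = card V - card (\<Union>M)"
      unfolding X_def using MV fin by (intro card_Diff_subset) (auto intro: finite_subset)
    moreover have "card (\<Union>M) \<le> card V" using MV fin by (intro card_mono) auto
    ultimately have "k \<le> card M" using card_Union_pairs[OF two Md(1)] by linarith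
    then show ?thesis using Md(1,2) finM by (auto simp: P_def)
  qed
qed

text \<open>A set \<open>Y\<close> violating Hall's condition could join the side of
  \<open>A\<close>: together they are joined to the part of \<open>B\<close> that contains no
  \<open>h\<close>-non-neighbour of \<open>Y\<close>, and as the pair is tight this exceeds the
  bound in \<open>spread\<close>. If that part is empty, \<open>k <= card B\<close> decides.\<close>

lemma cut_hall:
  assumes fin: "finite V" and spread: "spread k V" and AB: "A \<subseteq> V" "B \<subseteq> V" "A \<noteq> {}" "joined A B"
    and tight: "card A + card B + k = card V" and B: "k \<le> card B"
  shows "\<exists>g. inj_on g (V - A - B) \<and> (\<forall>x\<in>V - A - B. g x \<in> B \<and> \<not> h x (g x))"
proof -
  let ?X = "V - A - B"
  have finAB: "finite A" "finite B" using AB fin by (auto intro: finite_subset)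
  have "card (V - (A \<union> B)) = card V - card (A \<union> B)"
    using AB finAB by (intro card_Diff_subset) auto
  moreover have "card (A \<union> B) = card A + card B"
    using joined_disjoint[OF AB(4)] finAB by (rule_tac card_Un_disjoint)
  ultimately have X: "card ?X = k" using tight by (simp add: Diff_eq Int_assoc)
  define N where "N x = {c \<in> B. \<not> h x c}" for x
  have "\<exists>g. inj_on g ?X \<and> (\<forall>x\<in>?X. g x \<in> N x)"
  proof (rule hall)
    fix Y assume Y: "Y \<subseteq> ?X"
    have finY: "finite Y" using Y fin by (meson finite_Diff finite_subset)
    have NB: "\<Union>(N ` Y) \<subseteq> B" by (auto simp: N_def)
    let ?D = "B - \<Union>(N ` Y)"
    have cD: "card ?D = card B - card (\<Union>(N ` Y))"
      using NB finAB by (intro card_Diff_subset) (auto intro: finite_subset)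
    show "card Y \<le> card (\<Union>(N ` Y))"
    proof (cases "?D = {}")
      case True
      then have "\<Union>(N ` Y) = B" using NB by blast
      moreover have "card Y \<le> card ?X" using Y fin by (intro card_mono) auto
      ultimately show ?thesis using X B by simp
    next
      case False
      have "joined (A \<union> Y) ?D" using AB(4) by (auto simp: joined_def N_def)
      then have "card (A \<union> Y) + card ?D + k \<le> card V"
        using False AB Y by (intro spreadD[OF spread]) auto
      moreover have "card (A \<union> Y) = card A + card Y"
        using Y finY finAB by (intro card_Un_disjoint) auto
      moreover have "card (\<Union>(N ` Y)) \<le> card B" using NB finAB by (intro card_mono) auto
      ultimately show ?thesis using tight cD by linarith
    qed
  qed (use fin finAB in \<open>auto simp: N_def\<close>)
  then show ?thesis by (auto simp: N_def)
qed

text \<open>The stable-set bound for \<open>B\<close> leaves only \<open>card A = k - 1\<close>, one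
  too few for the \<open>k\<close> vertices of \<open>X\<close>. So all but one vertex of
  \<open>X\<close> use a vertex of \<open>A\<close> and one of \<open>B\<close>, while the remaining
  \<open>x\<close> uses two vertices of \<open>B\<close>, one an \<open>h\<close>-neighbour and one
  not.\<close>

lemma cut_unbalanced:
  assumes fin: "finite V" and spread: "spread k V" and AB: "A \<subseteq> V" "B \<subseteq> V" "A \<noteq> {}" "B \<noteq> {}" "joined A B"
    and tight: "card A + card B + k = card V" and large: "3 * k \<le> card V"
    and stab: "\<And>Q. Q \<subseteq> V \<Longrightarrow> stable Q \<Longrightarrow> card Q + 2 * k \<le> card V + 1"
    and A: "card A < k"
  shows "packs k V"
proof -
  define X where "X = V - A - B"
  have finAB: "finite A" "finite B" "finite X" using AB fin by (auto intro: finite_subset simp: X_def)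
  have disj: "A \<inter> B = {}" by (rule joined_disjoint) (rule AB)
  have "card (V - (A \<union> B)) = card V - card (A \<union> B)"
    using AB finAB by (intro card_Diff_subset) auto
  moreover have "card (A \<union> B) = card A + card B"
    using disj finAB by (intro card_Un_disjoint)
  ultimately have X: "card X = k" using tight by (simp add: X_def Diff_eq Int_assoc)
  have stB: "stable B" using joined_stable AB by blast
  have cA: "card A = k - 1" and cB: "card X < card B"
    using stab[OF AB(2) stB] A tight large X by linarith+
  \<comment> \<open>\<open>B\<close> attains the stable-set bound, so it cannot be extended by
    \<open>x\<close>.\<close>
  have nb: "\<exists>c\<in>B. h x c" if x: "x \<in> X" for x
  proof (rule ccontr)
    assume "\<not> ?thesis"
    then have "stable (insert x B)" using stB sym irrefl by (auto simp: stable_def)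
    then have "card (insert x B) + 2 * k \<le> card V + 1" using x AB by (intro stab) (auto simp: X_def)
    moreover have "x \<notin> B" using x by (simp add: X_def)
    ultimately show False using finAB cA tight A by simp
  qed
  have xA: "\<not> h a x" if "x \<in> X" "a \<in> A" for x a
    using nb[OF that(1)] that(2) AB(5) no_triangle sym unfolding joined_def by blast
  have "\<exists>g. inj_on g X \<and> (\<forall>x\<in>X. g x \<in> B \<and> \<not> h x (g x))"
    unfolding X_def using cB X by (intro cut_hall[OF fin spread AB(1-3,5) tight]) simp
  then obtain g where g: "inj_on g X" "\<And>x. x \<in> X \<Longrightarrow> g x \<in> B \<and> \<not> h x (g x)" by blast
  \<comment> \<open>Some \<open>h\<close>-neighbour \<open>c\<close> of \<open>x\<close> has to be
    left free by the matching. If \<open>c = g x1\<close>, then \<open>x1\<close> moves to a free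
    vertex \<open>d\<close>; should \<open>d\<close> be an \<open>h\<close>-neighbour of
    \<open>x1\<close>, the pair \<open>x1\<close>, \<open>d\<close> serves instead.\<close>
  have "\<exists>g x c. inj_on g X \<and> (\<forall>x\<in>X. g x \<in> B \<and> \<not> h x (g x)) \<and> x \<in> X \<and> c \<in> B - g ` X \<and> h x c"
  proof -
    have "X \<noteq> {}" using X A by auto
    then obtain x where x: "x \<in> X" by blast
    then obtain c where c: "c \<in> B" "h x c" using nb by blast
    show ?thesis
    proof (cases "c \<in> g ` X")
      case False
      then show ?thesis using g x c by blast
    next
      case True
      then obtain x1 where x1: "x1 \<in> X" "c = g x1" by blast
      have "card (g ` X) < card B" using cB card_image_le[OF finAB(3), of g] by linarith
      then have "\<not> B \<subseteq> g ` X" using finAB(3) by (meson card_mono finite_imageI not_less)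
      then obtain d where d: "d \<in> B" "d \<notin> g ` X" by blast
      show ?thesis
      proof (cases "h x1 d")
        case True
        then show ?thesis using g x1 d by blast
      next
        case False
        have "inj_on (g(x1 := d)) X" using g(1) d(2) by (auto simp: inj_on_def)
        moreover have "\<forall>y\<in>X. (g(x1 := d)) y \<in> B \<and> \<not> h y ((g(x1 := d)) y)" using g(2) d False by simp
        moreover have "c \<notin> (g(x1 := d)) ` X" using x1 d g(1) by (auto simp: inj_on_def)
        ultimately show ?thesis using x c by blast
      qed
    qed
  qed
  then obtain g x c where g: "inj_on g X" "\<And>x. x \<in> X \<Longrightarrow> g x \<in> B \<and> \<not> h x (g x)"
    and x: "x \<in> X" and c: "c \<in> B" "c \<notin> g ` X" "h x c" by blast
  have "card (X - {x}) = card A" using x finAB X cA by (simp add: card_Diff_singleton)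
  then obtain f where f: "bij_betw f (X - {x}) A"
    using finAB by (metis finite_Diff finite_same_card_bij)
  then have fA: "f y \<in> A" if "y \<in> X - {x}" for y using that by (auto simp: bij_betw_def)
  obtain xs where xs: "set xs = X - {x}" "distinct xs" using finAB by (metis finite_Diff finite_distinct_list)
  let ?ts = "map (\<lambda>y. (f y, y, g y)) xs"
  have sts: "set (triple_verts ?ts) = f ` (X - {x}) \<union> (X - {x}) \<union> g ` (X - {x})"
    using xs(1) by (auto simp: set_triple_verts)
  have XAB: "X \<inter> A = {}" "X \<inter> B = {}" "X \<subseteq> V" by (auto simp: X_def)
  have gB: "g ` X \<subseteq> B" using g(2) by blast
  have fAi: "f ` (X - {x}) \<subseteq> A" and gBi: "g ` (X - {x}) \<subseteq> B" using fA gB by blast+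
  show ?thesis
  proof (rule packsI[of "(x, g x, c) # ?ts"])
    have "length xs = card (X - {x})" using xs distinct_card by metis
    then show "length ((x, g x, c) # ?ts) = k" using X x finAB A by (simp add: card_Diff_singleton)
    have "distinct (triple_verts ?ts)"
    proof (rule distinct_triple_verts_map[OF xs(2)])
      show "inj_on f (set xs)" using f xs by (simp add: bij_betw_def)
      show "inj_on g (set xs)" using g(1) xs by (auto intro: inj_on_subset)
      show "f ` set xs \<inter> set xs = {}" "g ` set xs \<inter> set xs = {}" "f ` set xs \<inter> g ` set xs = {}"
        unfolding xs(1) using fAi gBi XAB disj by blast+
    qed
    moreover have "x \<notin> f ` (X - {x})" "g x \<notin> f ` (X - {x})" "c \<notin> f ` (X - {x})"
      using fAi XAB(1) disj x c(1) g(2)[OF x] by blast+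
    moreover have "x \<notin> g ` (X - {x})" "g x \<notin> g ` (X - {x})" "c \<notin> g ` (X - {x})"
      using gB XAB(2) x c(2) g(1) by (auto simp: inj_on_def)
    moreover have XB: "z \<notin> B" if "z \<in> X" for z using that by (simp add: X_def)
    have "g x \<notin> X" "c \<notin> X" using XB g(2)[OF x] c(1) by metis+
    moreover have "x \<noteq> g x" "x \<noteq> c" using XB[OF x] g(2)[OF x] c(1) by metis+
    moreover have "g x \<noteq> c" using c(2) x by (metis imageI)
    ultimately show "distinct (triple_verts ((x, g x, c) # ?ts))" by (simp add: sts)
    have "set (triple_verts ?ts) \<subseteq> V" unfolding sts using fAi gBi XAB(3) AB(1,2) by blast
    then show "set (triple_verts ((x, g x, c) # ?ts)) \<subseteq> V" using x c(1) gB XAB(3) AB(1,2) by auto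
    have "odd3 x (g x) c" using g(2)[OF x] c stB by (auto simp: odd3_def stable_def)
    moreover have "odd3 (f y) y (g y)" if "y \<in> X - {x}" for y
      using that fA[OF that] g(2)[of y] xA[of y "f y"] AB(5) by (auto simp: odd3_def joined_def)
    ultimately show "\<forall>(x, y, z)\<in>set ((x, g x, c) # ?ts). odd3 x y z" using xs(1) by auto
  qed
qed

text \<open>When both sides have at least \<open>k\<close> vertices, each of the \<open>k\<close>
  vertices outside is matched to an \<open>h\<close>-non-neighbour on either side; its two partners
  then form the only \<open>h\<close>-edge of the triple.\<close>

lemma packs_of_tight_cut:
  assumes fin: "finite V" and spread: "spread k V" and AB: "A \<subseteq> V" "B \<subseteq> V" "A \<noteq> {}" "B \<noteq> {}" "joined A B"
    and tight: "card V \<le> card A + card B + k" and large: "3 * k \<le> card V"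
    and stab: "\<And>Q. Q \<subseteq> V \<Longrightarrow> stable Q \<Longrightarrow> card Q + 2 * k \<le> card V + 1"
  shows "packs k V"
proof -
  have tight: "card A + card B + k = card V"
    using tight spreadD[OF spread AB] by simp
  consider "card A < k" | "card B < k" | "k \<le> card A" "k \<le> card B" by linarith
  then show ?thesis
  proof cases
    case 1
    then show ?thesis using cut_unbalanced[OF fin spread AB tight large stab] by blast
  next
    case 2
    then show ?thesis
      using cut_unbalanced[OF fin spread AB(2,1,4,3) joined_sym[OF AB(5)] _ large stab] tight
      by (simp add: add.commute)
  next
    case 3
    define X where "X = V - A - B"
    have X': "X = V - B - A" by (auto simp: X_def)
    have finAB: "finite A" "finite B" "finite X" using AB fin by (auto intro: finite_subset simp: X_def)
    have disj: "A \<inter> B = {}" by (rule joined_disjoint) (rule AB)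
    have "card (V - (A \<union> B)) = card V - card (A \<union> B)"
      using AB finAB by (intro card_Diff_subset) auto
    moreover have "card (A \<union> B) = card A + card B"
      using disj finAB by (intro card_Un_disjoint)
    ultimately have X: "card X = k" using tight by (simp add: X_def Diff_eq Int_assoc)
    obtain g where g: "inj_on g X" "\<And>x. x \<in> X \<Longrightarrow> g x \<in> B \<and> \<not> h x (g x)"
      using cut_hall[OF fin spread AB(1-3,5) tight 3(2)] unfolding X_def by blast
    obtain f where f: "inj_on f X" "\<And>x. x \<in> X \<Longrightarrow> f x \<in> A \<and> \<not> h x (f x)"
      using cut_hall[OF fin spread AB(2,1,4) joined_sym[OF AB(5)] _ 3(1)] tight
      unfolding X' by (metis add.commute)
    obtain xs where xs: "set xs = X" "distinct xs" using finAB finite_distinct_list by metis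
    let ?ts = "map (\<lambda>y. (f y, y, g y)) xs"
    have XAB: "X \<inter> A = {}" "X \<inter> B = {}" "X \<subseteq> V" by (auto simp: X_def)
    have fg: "f ` X \<subseteq> A" "g ` X \<subseteq> B" using f(2) g(2) by blast+
    show ?thesis
    proof (rule packsI[of ?ts])
      show "length ?ts = k" using X xs distinct_card by force
      show "distinct (triple_verts ?ts)"
      proof (rule distinct_triple_verts_map[OF xs(2)])
        show "f ` set xs \<inter> set xs = {}" "g ` set xs \<inter> set xs = {}" "f ` set xs \<inter> g ` set xs = {}"
          unfolding xs(1) using fg XAB disj by blast+
      qed (use f(1) g(1) xs in simp_all)
      show "set (triple_verts ?ts) \<subseteq> V"
      proof -
        have "set (triple_verts ?ts) = f ` X \<union> X \<union> g ` X" using xs(1) by (auto simp: set_triple_verts)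
        then show ?thesis using fg XAB(3) AB(1,2) by blast
      qed
      have "odd3 (f y) y (g y)" if "y \<in> X" for y
        using f(2)[OF that] g(2)[OF that] AB(5) h_comm[of y "f y"] by (auto simp: odd3_def joined_def)
      then show "\<forall>(x, y, z)\<in>set ?ts. odd3 x y z" using xs(1) by auto
    qed
  qed
qed

section \<open>Augmentation along alternating paths\<close>

lemma packs_append:
  assumes "packs m U" "distinct (triple_verts us)" "U \<inter> set (triple_verts us) = {}"
    "\<forall>(u, v, w)\<in>set us. odd3 u v w"
  shows "packs (m + length us) (U \<union> set (triple_verts us))"
proof -
  obtain ts where ts: "length ts = m" "distinct (triple_verts ts)" "set (triple_verts ts) \<subseteq> U"
    "\<forall>(x, y, z)\<in>set ts. odd3 x y z" using assms(1) unfolding packs_def by blast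
  show ?thesis
  proof (rule packsI[of "ts @ us"])
    show "distinct (triple_verts (ts @ us))" using ts(2,3) assms(2,3) by auto
    show "set (triple_verts (ts @ us)) \<subseteq> U \<union> set (triple_verts us)" using ts(3) by auto
    show "\<forall>(x, y, z)\<in>set (ts @ us). odd3 x y z" using ts(4) assms(4) by auto
  qed (use ts(1) in simp)
qed

text \<open>Every step of the walk, within a triple or between triples, changes the value of
  \<open>h x\<close> by \<open>type_flip\<close>, and the number of steps is
  \<open>2 * length ts + 1\<close>.\<close>

lemma alternating_types:
  assumes "alt_path (odd3 b) s ts z" and xy: "h x y" "\<not> odd3 b x y"
    and "\<forall>(p, q, w)\<in>set ts. odd3 b p q \<and> {p, q} \<subseteq> F" and "s \<in> F" "z \<in> F"
    and F: "\<And>t. t \<in> F \<Longrightarrow> \<not> odd3 b x t \<and> \<not> odd3 b y t"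
  shows "h x s \<noteq> h x z"
proof -
  have edge: "h x s \<noteq> h x t" if "s \<in> F" "t \<in> F" "odd3 b s t" for s t
  proof (rule type_flip[OF xy(1)])
    show "\<not> odd3 x y s" "\<not> odd3 x y t" "odd3 x s t"
      using F[OF that(1)] F[OF that(2)] that(3) xy(2)
      by (simp_all add: four_point[of x y s b] four_point[of x y t b] four_point[of x s t b])
  qed
  show ?thesis using assms(1,4,5)
  proof (induction ts arbitrary: s rule: triple_verts.induct)
    case 1
    then show ?case using edge[of s z] assms(6) by simp
  next
    case (2 p q w ts)
    have pq: "p \<in> F" "q \<in> F" "odd3 b p q" "odd3 b s p" using 2 by auto
    have "h x q \<noteq> h x z" using 2 by auto
    then show ?case using edge[OF pq(1,2,3)] edge[OF "2.prems"(3) pq(1,4)] by blast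
  qed
qed

text \<open>If \<open>us\<close> cannot be enlarged and the pentagon of
  \<open>third_adjacent\<close> does not occur, an augmenting path against the larger matching
  \<open>N\<close> has third vertices of triples as both ends, and neither \<open>x\<close> nor
  \<open>y\<close> sees any vertex of it. Parity along the path then contradicts the equal types of
  its ends.\<close>

lemma augment:
  assumes us: "distinct (triple_verts us)" "\<And>u v w. (u, v, w) \<in> set us \<Longrightarrow> odd3 b u v \<and> odd3 u v w"
    and L: "L \<inter> set (triple_verts us) = {}" "b \<in> L" "x \<in> L" "y \<in> L" "distinct [b, x, y]" "h x y"
    and Lno: "\<And>p q r. p \<in> L \<Longrightarrow> q \<in> L \<Longrightarrow> r \<in> L \<Longrightarrow> \<not> odd3 p q r"
    and V: "V = L \<union> set (triple_verts us)"
    and N: "finite N" "length us < card N" "disjoint N"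
      "\<And>e. e \<in> N \<Longrightarrow> \<exists>p\<in>V. \<exists>q\<in>V. e = {p, q} \<and> odd3 b p q"
    and nopack: "\<not> packs (Suc (length us)) V"
  shows "L = {b, x, y} \<and> (\<exists>u v w. (u, v, w) \<in> set us \<and> (pentagon b u v y w x \<or> pentagon b v u y w x))"
proof (rule ccontr)
  assume nopent: "\<not> ?thesis"
  note comm = odd3_comm[of b]
  have LE: "\<not> odd3 b m n" if "m \<in> L" "n \<in> L" for m n using Lno[OF L(2)] that by blast
  have neq: "x \<noteq> b" "y \<noteq> b" "x \<noteq> y" using L(5) by auto
  \<comment> \<open>Two triples in place of one would enlarge the packing; this provides the local
    hypothesis of \<open>third_adjacent\<close>.\<close>
  have nopack2: "\<not> packs 2 ({u, v, w} \<union> L)" if uvw: "(u, v, w) \<in> set us" for u v w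
  proof
    assume p: "packs 2 ({u, v, w} \<union> L)"
    obtain us1 us2 where split: "us = us1 @ (u, v, w) # us2" using uvw by (meson split_list)
    have "packs (2 + length (us1 @ us2)) (({u, v, w} \<union> L) \<union> set (triple_verts (us1 @ us2)))"
    proof (rule packs_append[OF p])
      show "distinct (triple_verts (us1 @ us2))" using us(1) split by auto
      show "({u, v, w} \<union> L) \<inter> set (triple_verts (us1 @ us2)) = {}" using us(1) L(1) split by auto
      show "\<forall>(u, v, w)\<in>set (us1 @ us2). odd3 u v w" using us(2) split by auto
    qed
    moreover have "({u, v, w} \<union> L) \<union> set (triple_verts (us1 @ us2)) = V" using V split by auto
    ultimately show False using nopack split by simp
  qed
  \<comment> \<open>Closed under flipping, since a path may traverse a matching edge in either
    direction.\<close>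
  define T where "T = {(p, q, w). (p, q, w) \<in> set us \<or> (q, p, w) \<in> set us}"
  have T_sym: "(q, p, w) \<in> T" if "(p, q, w) \<in> T" for p q w using that by (auto simp: T_def)
  have T_odd: "odd3 b p q" "odd3 p q w" if T: "(p, q, w) \<in> T" for p q w
  proof -
    consider "(p, q, w) \<in> set us" | "(q, p, w) \<in> set us" using T by (auto simp: T_def)
    then have "odd3 b p q \<and> odd3 p q w"
    proof cases
      case 2
      then show ?thesis using us(2)[OF 2] odd3_comm odd3_rot by metis
    qed (use us(2) in blast)
    then show "odd3 b p q" "odd3 p q w" by blast+
  qed
  have T_verts: "p \<in> set (triple_verts us)" "q \<in> set (triple_verts us)" "w \<in> set (triple_verts us)"
    if "(p, q, w) \<in> T" for p q w
    using that in_triple_verts[of p q w us] in_triple_verts[of q p w us] by (auto simp: T_def)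
  have T_disj: "{p, q, w} \<inter> L = {}" if "(p, q, w) \<in> T" for p q w
    using T_verts[OF that] L(1) by blast
  have T_dist: "distinct [p, q, w]" if "(p, q, w) \<in> T" for p q w
    using that triple_verts_distinct_triple[OF us(1)] by (fastforce simp: T_def)
  have T_nopack: "\<not> packs 2 ({p, q, w} \<union> L)" if "(p, q, w) \<in> T" for p q w
    using that nopack2[of p q w] nopack2[of q p w] by (auto simp: T_def insert_commute)
  have T_third: "\<not> odd3 b m w" if T: "(p, q, w) \<in> T" and m: "m \<in> L" for p q w m
  proof
    assume a: "odd3 b m w"
    have "L = {b, x, y} \<and> (pentagon b p q y w x \<or> pentagon b q p y w x)"
      using third_adjacent[OF T_dist[OF T] T_disj[OF T] T_odd(2)[OF T] T_odd(1)[OF T] L(2-6) Lno m a T_nopack[OF T]] .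
    moreover have "(p, q, w) \<in> set us \<or> (q, p, w) \<in> set us" using T by (simp add: T_def)
    ultimately show False using nopent by blast
  qed
  \<comment> \<open>If \<open>p w\<close> is an edge, the triple is a triangle of edges and
    \<open>p\<close> can act as its third vertex in \<open>third_adjacent\<close>; the pentagon
    found there would make \<open>p q\<close> and \<open>p w\<close> non-edges.\<close>
  have T_tri: "\<not> odd3 b m p" if T: "(p, q, w) \<in> T" and m: "m \<in> L" and pw: "odd3 b p w" for p q w m
  proof
    assume a: "odd3 b m p"
    have d: "distinct [q, w, p]" "{q, w, p} \<inter> L = {}" using T_dist[OF T] T_disj[OF T] by auto
    have o: "odd3 q w p" using T_odd(2)[OF T] odd3_rot by blast
    have qw: "odd3 b q w"
      using T_odd[OF T] pw by (simp add: four_point[of p q w b] comm)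
    have np: "\<not> packs 2 ({q, w, p} \<union> L)" using T_nopack[OF T] by (simp add: insert_commute)
    have "pentagon b q w y p x \<or> pentagon b w q y p x"
      using third_adjacent[OF d o qw L(2-6) Lno m a np] by blast
    then show False using T_odd(1)[OF T] pw unfolding pentagon_def by (auto simp: comm)
  qed
  let ?W = "\<Union>(edge_of ` set us)"
  have T_edge: "p \<in> ?W" "q \<in> ?W" if "(p, q, w) \<in> T" for p q w
    using that by (force simp: T_def)+
  have exposed: "\<exists>u v. (u, v, s) \<in> set us" if "s \<in> V" "s \<notin> L" "s \<notin> ?W" for s
    using that V by (fastforce simp: set_triple_verts)
  \<comment> \<open>By \<open>walk\<close>, no path to an exposed vertex starts in \<open>L\<close>
    at a vertex other than \<open>b\<close>; the spare vertex \<open>l\<close> is one of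
    \<open>x\<close>, \<open>y\<close> different from the start.\<close>
  have walkL: False if s: "s \<in> L" "s \<noteq> b" and path: "alt_path (odd3 b) s ts z"
    and ts: "distinct (triple_verts ts)" "\<forall>(p, q, w)\<in>set ts. (p, q, w) \<in> T"
    and z: "z \<in> V" "z \<noteq> s" "z \<noteq> b" "z \<notin> ?W" for s ts z
  proof -
    obtain vs where vs: "set vs \<subseteq> set us" "length ts + length vs = length us"
      "distinct (triple_verts (ts @ vs))" "set (triple_verts (ts @ vs)) = set (triple_verts us)"
      "\<forall>(p, q, w)\<in>set us. (p, q, w) \<in> set (ts @ vs) \<or> (q, p, w) \<in> set ts"
      using complementary_triples[OF us(1) ts(1)] ts(2) unfolding T_def by auto
    define l where "l = (if s = x then y else x)"
    have l: "l \<in> L" "l \<noteq> b" "l \<noteq> s" using L(3,4) neq by (auto simp: l_def)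
    have vsT: "(p, q, w) \<in> T" if "(p, q, w) \<in> set vs" for p q w using that vs(1) by (auto simp: T_def)
    have "packs (Suc (length ts + length vs)) (set (z # s # b # l # triple_verts ts @ triple_verts vs))"
    proof (rule walk[OF path])
      show "distinct (s # b # l # triple_verts ts @ triple_verts vs)"
      proof -
        have "distinct (triple_verts ts @ triple_verts vs)" using vs(3) by simp
        moreover have "m \<notin> set (triple_verts ts @ triple_verts vs)" if "m \<in> L" for m
          using that L(1) vs(4) by auto
        ultimately show ?thesis using s l L(2) by simp
      qed
      show "\<forall>(p, q, w)\<in>set ts. odd3 b p q \<and> odd3 p q w \<and> \<not> odd3 b w l \<and> (odd3 b p w \<longrightarrow> \<not> odd3 b p l)"
        using ts(2) T_odd T_third[OF _ l(1)] T_tri[OF _ l(1)] by (fastforce simp: comm)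
      show "\<forall>(p, q, w)\<in>set vs. odd3 b p q \<and> odd3 p q w \<and> \<not> odd3 b w l"
        using vsT T_odd T_third[OF _ l(1)] by (fastforce simp: comm)
      show "z \<notin> set (s # b # triple_verts ts @ triple_verts vs) \<or> (\<exists>p q. (p, q, z) \<in> set (ts @ vs))"
      proof (cases "z \<in> L")
        case True
        then have "z \<notin> set (triple_verts (ts @ vs))" using L(1) vs(4) by auto
        then show ?thesis using z by simp
      next
        case False
        then obtain u v where "(u, v, z) \<in> set us" using exposed z by blast
        then show ?thesis using vs(5) by fastforce
      qed
    qed
    moreover have "set (z # s # b # l # triple_verts ts @ triple_verts vs) \<subseteq> V"
      using vs(4) V z(1) s(1) L(2) l(1) by auto
    ultimately have "packs (Suc (length ts + length vs)) V" by (rule packs_mono)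
    then show False using vs(2) nopack by simp
  qed
  have "\<exists>s z ts. alt_path (\<lambda>p q. {p, q} \<in> N) s ts z \<and> s \<noteq> z \<and> s \<in> \<Union>N \<and> z \<in> \<Union>N \<and>
    s \<notin> ?W \<and> z \<notin> ?W \<and> distinct (triple_verts ts) \<and>
    (\<forall>(p, q, w)\<in>set ts. (p, q, w) \<in> set us \<or> (q, p, w) \<in> set us)"
  proof (rule augmenting_path)
    show "card (set us) < card N" using N(2) card_length[of us] by linarith
    show "card e = 2" if e: "e \<in> N" for e
    proof -
      obtain p q where "e = {p, q}" "odd3 b p q" using N(4)[OF e] by blast
      then show ?thesis using odd3_distinct[of b p q] by auto
    qed
    show "distinct [u, v, w]" if "(u, v, w) \<in> set us" for u v w
      using triple_verts_distinct_triple[OF us(1) that] .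
    show "{u, v, w} \<inter> {u', v', w'} = {}"
      if "(u, v, w) \<in> set us" "(u', v', w') \<in> set us" "(u, v, w) \<noteq> (u', v', w')" for u v w u' v' w'
      using triple_verts_disjoint[OF us(1) that] .
  qed (use N in auto)
  then obtain s z ts where path': "alt_path (\<lambda>p q. {p, q} \<in> N) s ts z" and sz: "s \<noteq> z"
    "s \<in> \<Union>N" "z \<in> \<Union>N" "s \<notin> ?W" "z \<notin> ?W" and dts: "distinct (triple_verts ts)"
    and ts': "\<forall>(p, q, w)\<in>set ts. (p, q, w) \<in> set us \<or> (q, p, w) \<in> set us" by blast
  have tsT1: "(p, q, w) \<in> T" if "(p, q, w) \<in> set ts" for p q w
    using that ts' by (auto simp: T_def)
  have NE: "odd3 b p q" if pq: "{p, q} \<in> N" for p q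
  proof -
    obtain p' q' where "{p, q} = {p', q'}" "odd3 b p' q'" using N(4)[OF pq] by blast
    then show ?thesis using comm by (metis doubleton_eq_iff)
  qed
  have path: "alt_path (odd3 b) s ts z" using path' by (rule alt_path_mono) (rule NE)
  have NV: "t \<in> V \<and> t \<noteq> b" if t: "t \<in> \<Union>N" for t
  proof -
    obtain e where "e \<in> N" "t \<in> e" using t by blast
    then obtain p q where "p \<in> V" "q \<in> V" "t \<in> {p, q}" "odd3 b p q" using N(4) by metis
    then show ?thesis using odd3_distinct[of b p q] by auto
  qed
  note sV = NV[OF sz(2)] and zV = NV[OF sz(3)]
  have E_comm: "odd3 b p q = odd3 b q p" for p q by (rule comm)
  have tsT: "\<forall>(p, q, w)\<in>set ts. (p, q, w) \<in> T" using tsT1 by blast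
  have sL: "s \<notin> L" using walkL[OF _ _ path dts tsT] sV zV sz by blast
  have zL: "z \<notin> L"
  proof
    assume "z \<in> L"
    moreover have "\<forall>(p, q, w)\<in>set (rev (map flip ts)). (p, q, w) \<in> T" using tsT1 T_sym by auto
    ultimately show False
      using walkL[OF _ _ alt_path_rev[OF E_comm path]] dts sV zV sz by (auto simp: triple_verts_flip)
  qed
  \<comment> \<open>An edge from \<open>m\<close> to a path vertex \<open>p\<close> gives an
    alternating path that starts at \<open>m\<close>, enters at \<open>p\<close>, leaves through
    \<open>q\<close> and follows the old path to its end on that side, against
    \<open>walkL\<close>.\<close>
  have tsL: "\<not> odd3 b m p" if m: "m \<in> L" and "(p, q, w) \<in> set ts \<or> (q, p, w) \<in> set ts" for m p q w
  proof
    assume a: "odd3 b m p"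
    then have mb: "m \<noteq> b" by auto
    from that(2) show False
    proof
      assume "(p, q, w) \<in> set ts"
      then obtain ts1 ts2 where split: "ts = ts1 @ (p, q, w) # ts2" by (meson split_list)
      have "alt_path (odd3 b) m ((p, q, w) # ts2) z" using path a split by (simp add: alt_path_append)
      moreover have "distinct (triple_verts ((p, q, w) # ts2))" using dts split by simp
      moreover have "\<forall>(p, q, w)\<in>set ((p, q, w) # ts2). (p, q, w) \<in> T" using tsT1 split by auto
      ultimately show False using walkL[OF m mb] zV zL m sz(5) by metis
    next
      assume "(q, p, w) \<in> set ts"
      then obtain ts1 ts2 where split: "ts = ts1 @ (q, p, w) # ts2" by (meson split_list)
      have "alt_path (odd3 b) s ts1 q" using path split by (simp add: alt_path_append)
      then have "alt_path (odd3 b) m ((p, q, w) # rev (map flip ts1)) s"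
        using a alt_path_rev[OF E_comm] by simp
      moreover have "distinct (triple_verts ((p, q, w) # rev (map flip ts1)))"
        using dts split by (auto simp: triple_verts_flip)
      moreover have "\<forall>(p, q, w)\<in>set ((p, q, w) # rev (map flip ts1)). (p, q, w) \<in> T"
        using tsT1 split T_sym by auto
      ultimately show False using walkL[OF m mb] sV sL m sz(4) by metis
    qed
  qed
  \<comment> \<open>The third vertex \<open>s\<close> is replaced by \<open>l\<close> in its triple, which turns \<open>s\<close> into an unused starting point.\<close>
  have swap: False if path: "alt_path (odd3 b) s ts z" and szV: "s \<noteq> z" "z \<in> V" "z \<notin> L" "z \<notin> ?W" "s \<notin> ?W"
    and dts: "distinct (triple_verts ts)" and tsT1: "\<And>p q w. (p, q, w) \<in> set ts \<Longrightarrow> (p, q, w) \<in> T"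
    and tsL: "\<And>m p q w. m \<in> L \<Longrightarrow> (p, q, w) \<in> set ts \<Longrightarrow> \<not> odd3 b m p"
    and uv: "(u, v, s) \<in> set us" and l: "l \<in> L" "l \<noteq> b" "odd3 u v l" for s z ts u v l
  proof -
    obtain vs where vs: "set vs \<subseteq> set us" "length ts + length vs = length us"
      "distinct (triple_verts (ts @ vs))" "set (triple_verts (ts @ vs)) = set (triple_verts us)"
      "\<forall>(p, q, w)\<in>set us. (p, q, w) \<in> set (ts @ vs) \<or> (q, p, w) \<in> set ts"
      using complementary_triples[OF us(1) dts] tsT1 unfolding T_def by blast
    have allT: "(p, q, w) \<in> T" if "(p, q, w) \<in> set (ts @ vs)" for p q w
      using that vs(1) tsT1 by (auto simp: T_def)
    \<comment> \<open>Since \<open>l\<close> enters the packing, the spare vertex for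
      \<open>walk\<close> must be a vertex of \<open>{x, y}\<close> other than
      \<open>l\<close>.\<close>
    define n where "n = (if l = x then y else x)"
    have n: "n \<in> L" "n \<noteq> b" "n \<noteq> l" using L(3,4) neq by (auto simp: n_def)
    define r where "r = (\<lambda>w. if w = s then l else w)"
    let ?r = "\<lambda>(p, q, w). (p, q, r w)"
    have sus: "s \<in> set (triple_verts us)" using in_triple_verts[OF uv] by blast
    have sl: "s \<noteq> l" "s \<noteq> n" "s \<noteq> b" using sus L(1,2) l(1) n(1) by auto
    have dist: "distinct (triple_verts (map ?r (ts @ vs)))"
      unfolding r_def using vs(3,4) L(1) l(1) by (intro replace_third) auto
    have verts: "t \<in> insert l (set (triple_verts us)) - {s}" if t: "t \<in> set (triple_verts (map ?r (ts @ vs)))" for t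
    proof -
      obtain p q w where pqw: "(p, q, w) \<in> set (ts @ vs)" "t \<in> {p, q, r w}"
        using t unfolding set_triple_verts by auto
      note T = allT[OF pqw(1)]
      have "p \<noteq> s" "q \<noteq> s" using T_edge[OF T] szV(5) by auto
      then show ?thesis using pqw(2) T_verts[OF T] sl(1) by (auto simp: r_def split: if_splits)
    qed
    have third: "odd3 p q (r w) \<and> \<not> odd3 b (r w) n" if pqw: "(p, q, w) \<in> set (ts @ vs)" for p q w
    proof (cases "w = s")
      case False
      then show ?thesis
        using T_odd[OF allT[OF pqw]] T_third[OF allT[OF pqw] n(1)] by (simp add: r_def comm)
    next
      case True
      have "(p, q) = (u, v) \<or> (p, q) = (v, u)"
      proof (rule ccontr)
        assume "\<not> ?thesis"
        moreover have "(p, q, s) \<in> set us \<or> (q, p, s) \<in> set us" using allT[OF pqw] True by (simp add: T_def)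
        ultimately show False
          using triple_verts_disjoint[OF us(1) uv, of p q s] triple_verts_disjoint[OF us(1) uv, of q p s] by auto
      qed
      then have "odd3 p q l" using l(3) odd3_comm odd3_rot by (metis prod.inject)
      then show ?thesis using LE[OF l(1) n(1)] True by (simp add: r_def)
    qed
    have "packs (Suc (length (map ?r ts) + length (map ?r vs)))
      (set (z # s # b # n # triple_verts (map ?r ts) @ triple_verts (map ?r vs)))"
    proof (rule walk)
      show "alt_path (odd3 b) s (map ?r ts) z" using path by (simp add: alt_path_third)
      show "distinct (s # b # n # triple_verts (map ?r ts) @ triple_verts (map ?r vs))"
      proof -
        have "distinct (triple_verts (map ?r ts) @ triple_verts (map ?r vs))" using dist by simp
        moreover have "m \<notin> set (triple_verts (map ?r ts) @ triple_verts (map ?r vs))" if "m = s \<or> m \<in> L - {l}" for m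
          using that verts[of m] L(1) by auto
        ultimately show ?thesis using sl n L(2) l(2) by simp
      qed
      show "\<forall>(p, q, w)\<in>set (map ?r ts). odd3 b p q \<and> odd3 p q w \<and> \<not> odd3 b w n \<and> (odd3 b p w \<longrightarrow> \<not> odd3 b p n)"
      proof -
        have "odd3 b p q \<and> odd3 p q (r w) \<and> \<not> odd3 b (r w) n \<and> \<not> odd3 b p n" if "(p, q, w) \<in> set ts" for p q w
          using that third[of p q w] T_odd(1)[OF tsT1[OF that]] tsL[OF n(1) that] by (simp add: comm)
        then show ?thesis by auto
      qed
      show "\<forall>(p, q, w)\<in>set (map ?r vs). odd3 b p q \<and> odd3 p q w \<and> \<not> odd3 b w n"
      proof -
        have "odd3 b p q \<and> odd3 p q (r w) \<and> \<not> odd3 b (r w) n" if "(p, q, w) \<in> set vs" for p q w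
          using that third[of p q w] T_odd(1)[OF allT, of p q w] by simp
        then show ?thesis by auto
      qed
      obtain u' v' where "(u', v', z) \<in> set us" using exposed szV by blast
      then obtain p q where pqz: "(p, q, z) \<in> set (ts @ vs)" using vs(5) by fastforce
      have "?r (p, q, z) \<in> ?r ` set (ts @ vs)" by (rule imageI) (rule pqz)
      moreover have "?r (p, q, z) = (p, q, z)" using szV(1) by (simp add: r_def)
      moreover have "?r ` set (ts @ vs) = set (map ?r ts @ map ?r vs)" by (simp add: image_Un)
      ultimately have "(p, q, z) \<in> set (map ?r ts @ map ?r vs)" by argo
      then show "z \<notin> set (s # b # triple_verts (map ?r ts) @ triple_verts (map ?r vs)) \<or>
          (\<exists>p q. (p, q, z) \<in> set (map ?r ts @ map ?r vs))" by blast
    qed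
    moreover have "set (z # s # b # n # triple_verts (map ?r ts) @ triple_verts (map ?r vs)) \<subseteq> V"
    proof
      fix t assume "t \<in> set (z # s # b # n # triple_verts (map ?r ts) @ triple_verts (map ?r vs))"
      then have "t = z \<or> t = s \<or> t = b \<or> t = n \<or> t \<in> set (triple_verts (map ?r (ts @ vs)))" by simp
      then show "t \<in> V" using verts[of t] szV(2) sus L(2) n(1) l(1) V by auto
    qed
    ultimately have "packs (Suc (length (map ?r ts) + length (map ?r vs))) V" by (rule packs_mono)
    then show False using vs(2) nopack by simp
  qed
  \<comment> \<open>Every vertex of \<open>L\<close> other than \<open>b\<close> sees exactly one of
    \<open>u\<close> and \<open>v\<close>, and \<open>x\<close> and \<open>y\<close> see the same
    one, \<open>p\<close>. By \<open>type_flip\<close> the value of \<open>h x\<close> at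
    \<open>p\<close> differs from those at \<open>b\<close> and at \<open>w\<close>, so these two
    agree.\<close>
  have end_type: "h x w = h x b" if uvw: "(u, v, w) \<in> set us"
    and no: "\<And>l. l \<in> L \<Longrightarrow> l \<noteq> b \<Longrightarrow> \<not> odd3 u v l" for u v w
  proof -
    have diff: "odd3 b l u \<noteq> odd3 b l v" if "l \<in> L" "l \<noteq> b" for l
      using no[OF that] us(2)[OF uvw] by (auto simp: four_point[of u v l b] comm)
    have uvT: "(u, v, w) \<in> T" "(v, u, w) \<in> T" using uvw by (auto simp: T_def)
    have same: "\<not> (odd3 b x p \<and> odd3 b y q)" if pq: "(p, q) = (u, v) \<or> (p, q) = (v, u)" for p q
    proof
      assume a: "odd3 b x p \<and> odd3 b y q"
      have T: "(p, q, w) \<in> T" using pq uvT by auto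
      have "\<not> odd3 b p w" using T_tri[OF T L(3)] a by blast
      then have "odd3 p w x" using a T_third[OF T L(3)] by (simp add: four_point[of p w x b] comm)
      moreover have "odd3 b y q" using a by blast
      moreover have "distinct [b, y, q, p, w, x]" using T_dist[OF T] T_disj[OF T] L(2-5) by auto
      ultimately have "packs 2 ({p, q, w} \<union> L)" using L(2-4) by (intro packs2I[of b y q p w x]) auto
      then show False using T_nopack[OF T] by blast
    qed
    define p where "p = (if odd3 b x u then u else v)"
    define q where "q = (if odd3 b x u then v else u)"
    have pq: "(p, q) = (u, v) \<or> (p, q) = (v, u)" by (auto simp: p_def q_def)
    have T: "(p, q, w) \<in> T" using pq uvT by auto
    have xp: "odd3 b x p" using diff[OF L(3) neq(1)] by (auto simp: p_def)
    have yp: "odd3 b y p" using same[OF pq] xp diff[OF L(4) neq(2)] pq by auto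
    have pw: "\<not> odd3 b p w" using T_tri[OF T L(3)] xp by blast
    have "\<not> odd3 x y b" using Lno[OF L(3,4,2)] .
    moreover have "\<not> odd3 x y p" using xp yp LE[OF L(3,4)] by (simp add: four_point[of x y p b])
    moreover have "\<not> odd3 x y w" using T_third[OF T L(3)] T_third[OF T L(4)] LE[OF L(3,4)]
      by (simp add: four_point[of x y w b])
    moreover have "odd3 x p b" using xp odd3_rot by blast
    moreover have "odd3 x p w" using xp pw T_third[OF T L(3)] by (simp add: four_point[of x p w b])
    ultimately show ?thesis using type_flip[OF L(6)] by metis
  qed
  obtain u v where uvs: "(u, v, s) \<in> set us" using exposed sV sL sz(4) by blast
  obtain u' v' where uvz: "(u', v', z) \<in> set us" using exposed zV zL sz(5) by blast
  \<comment> \<open>\<open>swap\<close> excludes every replacement \<open>l\<close> in the triples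
    of the two ends, which is what \<open>end_type\<close> requires.\<close>
  have "h x s = h x b"
  proof (rule end_type[OF uvs])
    fix l assume l: "l \<in> L" "l \<noteq> b"
    show "\<not> odd3 u v l"
      using swap[OF path sz(1) _ zL sz(5,4) dts tsT1 _ uvs l] tsL zV by blast
  qed
  moreover have "h x z = h x b"
  proof (rule end_type[OF uvz])
    fix l assume l: "l \<in> L" "l \<noteq> b"
    have "(p, q, w) \<in> T" if "(p, q, w) \<in> set (rev (map flip ts))" for p q w
      using that tsT1 T_sym by auto
    moreover have "\<not> odd3 b m p" if "m \<in> L" "(p, q, w) \<in> set (rev (map flip ts))" for m p q w
      using tsL[OF that(1), of p q w] that(2) by auto
    ultimately show "\<not> odd3 u' v' l"
      using swap[OF alt_path_rev[OF E_comm path] sz(1)[symmetric] _ sL sz(4,5) _ _ _ uvz l] dts sV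
      by (auto simp: triple_verts_flip)
  qed
  moreover have "h x s \<noteq> h x z"
  proof (rule alternating_types[OF path L(6) LE[OF L(3,4)]])
    let ?F = "{t. \<not> odd3 b x t \<and> \<not> odd3 b y t}"
    show "s \<in> ?F" "z \<in> ?F"
      using T_third[of u v s] T_third[of u' v' z] uvs uvz L(3,4) by (auto simp: T_def)
    have "odd3 b p q \<and> p \<in> ?F \<and> q \<in> ?F" if "(p, q, w) \<in> set ts" for p q w
      using T_odd(1)[OF tsT1[OF that]] tsL[OF L(3), of p q w] tsL[OF L(3), of q p w]
        tsL[OF L(4), of p q w] tsL[OF L(4), of q p w] that by simp
    then show "\<forall>(p, q, w)\<in>set ts. odd3 b p q \<and> {p, q} \<subseteq> ?F" by auto
  qed blast
  ultimately show False by blast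
qed

section \<open>The packing theorem\<close>

text \<open>By \<open>four_point\<close> an odd triple contains an odd number of edges; one of them
  becomes its matching edge.\<close>

lemma orient_triples:
  assumes "\<forall>(x, y, z)\<in>set ts. odd3 x y z" "distinct (triple_verts ts)"
  shows "\<exists>us. length us = length ts \<and> distinct (triple_verts us) \<and>
    set (triple_verts us) = set (triple_verts ts) \<and>
    (\<forall>u v w. (u, v, w) \<in> set us \<longrightarrow> odd3 b u v \<and> odd3 u v w)"
  using assms
proof (induction ts rule: triple_verts.induct)
  case (2 x y z ts)
  then obtain us where us: "length us = length ts" "distinct (triple_verts us)"
    "set (triple_verts us) = set (triple_verts ts)"
    "\<And>u v w. (u, v, w) \<in> set us \<Longrightarrow> odd3 b u v \<and> odd3 u v w" by auto
  have xyz: "odd3 x y z" using 2 by simp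
  have "\<exists>u v w. {u, v, w} = {x, y, z} \<and> distinct [u, v, w] \<and> odd3 b u v \<and> odd3 u v w"
  proof -
    have yzx: "odd3 y z x" and zxy: "odd3 z x y" using xyz odd3_rot by blast+
    have d: "distinct [x, y, z]" using "2.prems" by simp
    consider "odd3 b x y" | "odd3 b y z" | "odd3 b z x"
      using xyz four_point[of x y z b] odd3_comm[of b x z] by blast
    then show ?thesis
    proof cases
      case 1
      then show ?thesis using xyz d by blast
    next
      case 2
      have "{y, z, x} = {x, y, z}" "distinct [y, z, x]" using d by auto
      then show ?thesis using 2 yzx by blast
    next
      case 3
      have "{z, x, y} = {x, y, z}" "distinct [z, x, y]" using d by auto
      then show ?thesis using 3 zxy by blast
    qed
  qed
  then obtain u v w where uvw: "{u, v, w} = {x, y, z}" "distinct [u, v, w]" "odd3 b u v" "odd3 u v w" by blast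
  have "{u, v, w} \<inter> set (triple_verts us) = {}" unfolding uvw(1) us(3) using "2.prems"(2) by auto
  then have "distinct (triple_verts ((u, v, w) # us))" using uvw(2) us(2) by simp
  moreover have "set (triple_verts ((u, v, w) # us)) = set (triple_verts ((x, y, z) # ts))"
  proof -
    have "set (triple_verts ((u, v, w) # us)) = {u, v, w} \<union> set (triple_verts us)" by auto
    also have "\<dots> = {x, y, z} \<union> set (triple_verts ts)" unfolding uvw(1) us(3) ..
    finally show ?thesis by auto
  qed
  ultimately show ?case
    using us(1,4) uvw(3,4) by (intro exI[of _ "(u, v, w) # us"]) auto
qed simp

text \<open>Induction on \<open>k\<close>: either a joined pair is tight, or two vertices
  \<open>x\<close>, \<open>y\<close> with \<open>h x y\<close> are deleted and the packing of the
  rest is augmented. The exception stems from a pentagon that makes up all of \<open>V\<close>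
  together with \<open>b\<close>.\<close>

theorem packs_of_spread:
  assumes "finite V" "3 * k \<le> card V" "spread k V"
    and "\<And>Q. Q \<subseteq> V \<Longrightarrow> stable Q \<Longrightarrow> card Q + 2 * k \<le> card V + 1"
  shows "packs k V \<or> (k = 2 \<and> card V = 6)"
  using assms
proof (induction k arbitrary: V)
  case 0
  show ?case by (intro disjI1 packsI[of "[]"]) auto
next
  case (Suc k)
  note fin = Suc.prems(1) and large = Suc.prems(2) and spr = Suc.prems(3) and stab = Suc.prems(4)
  show ?case
  proof (cases "spread (Suc (Suc k)) V")
    case False
    then obtain A B where AB: "A \<subseteq> V" "B \<subseteq> V" "A \<noteq> {}" "B \<noteq> {}" "joined A B"
      and "\<not> card A + card B + Suc (Suc k) \<le> card V" unfolding spread_def by blast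
    then have "card V \<le> card A + card B + Suc k" by linarith
    then show ?thesis using packs_of_tight_cut[OF fin spr AB _ large stab] by blast
  next
    case spr2: True
    have "\<not> stable V" using stab[of V] by auto
    then obtain x y where xy: "x \<in> V" "y \<in> V" "h x y" unfolding stable_def by blast
    then have "x \<noteq> y" using irrefl by blast
    define V' where "V' = V - {x, y}"
    have V': "V' \<subseteq> V" "finite V'" using fin by (auto simp: V'_def)
    have cV: "card V = card V' + 2"
    proof -
      have "card V' = card V - card {x, y}" unfolding V'_def using xy by (intro card_Diff_subset) auto
      then show ?thesis using large \<open>x \<noteq> y\<close> by simp
    qed
    \<comment> \<open>The deletion costs two vertices: \<open>spr2\<close> has a surplus of two to
      pay for them, and both sides of \<open>stab\<close> drop by two.\<close>
    have "packs k V' \<or> (k = 2 \<and> card V' = 6)"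
    proof (rule Suc.IH[OF V'(2)])
      show "3 * k \<le> card V'" using large cV by simp
      show "spread k V'" unfolding spread_def
      proof (intro allI impI)
        fix A B assume "A \<subseteq> V'" "B \<subseteq> V'" "A \<noteq> {}" "B \<noteq> {}" "joined A B"
        then have "card A + card B + Suc (Suc k) \<le> card V"
          using V'(1) by (intro spreadD[OF spr2]) auto
        then show "card A + card B + k \<le> card V'" using cV by simp
      qed
      show "card Q + 2 * k \<le> card V' + 1" if "Q \<subseteq> V'" "stable Q" for Q
        using stab[of Q] that V'(1) cV by auto
    qed
    \<comment> \<open>The exception would mean \<open>card V = 8\<close>, whereas
      \<open>large\<close> demands nine vertices for \<open>k = 2\<close>.\<close>
    then have "packs k V'" using large cV by auto
    then obtain ts where ts: "length ts = k" "distinct (triple_verts ts)" "set (triple_verts ts) \<subseteq> V'"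
      "\<forall>(x, y, z)\<in>set ts. odd3 x y z" unfolding packs_def by blast
    define L where "L = V - set (triple_verts ts)"
    have tsV: "set (triple_verts ts) \<subseteq> V" using ts(3) V'(1) by blast
    have cL: "card L + 3 * k = card V"
    proof -
      have "card L = card V - card (set (triple_verts ts))"
        unfolding L_def using tsV by (intro card_Diff_subset) auto
      moreover have "card (set (triple_verts ts)) = 3 * k"
        using distinct_card[OF ts(2)] ts(1) by (simp add: length_triple_verts)
      ultimately show ?thesis using large by simp
    qed
    have xyL: "x \<in> L" "y \<in> L" using xy ts(3) by (auto simp: L_def V'_def)
    show ?thesis
    proof (cases "\<exists>p\<in>L. \<exists>q\<in>L. \<exists>r\<in>L. odd3 p q r")
      case True
      then obtain p q r where pqr: "p \<in> L" "q \<in> L" "r \<in> L" "odd3 p q r" by blast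
      have "packs (Suc k) V"
      proof (rule packsI[of "(p, q, r) # ts"])
        show "distinct (triple_verts ((p, q, r) # ts))"
          using pqr odd3_distinct[OF pqr(4)] ts(2) by (auto simp: L_def)
        show "set (triple_verts ((p, q, r) # ts)) \<subseteq> V" using pqr tsV by (auto simp: L_def)
      qed (use pqr ts in auto)
      then show ?thesis by blast
    next
      case False
      have "\<not> L \<subseteq> {x, y}"
      proof
        assume "L \<subseteq> {x, y}"
        then have "card L \<le> card {x, y}" by (intro card_mono) auto
        then show False using cL large \<open>x \<noteq> y\<close> by simp
      qed
      then obtain b where b: "b \<in> L" "b \<noteq> x" "b \<noteq> y" by blast
      obtain us where us: "length us = length ts" "distinct (triple_verts us)"
        "set (triple_verts us) = set (triple_verts ts)"
        "\<And>u v w. (u, v, w) \<in> set us \<Longrightarrow> odd3 b u v \<and> odd3 u v w"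
        using orient_triples[OF ts(4,2)] by blast
      have bV: "b \<in> V" using b by (simp add: L_def)
      obtain N where N: "finite N" "Suc k \<le> card N" "disjoint N"
        "\<And>e. e \<in> N \<Longrightarrow> \<exists>p\<in>V. \<exists>q\<in>V. e = {p, q} \<and> odd3 b p q"
        using exists_odd_matching[OF fin bV spr stab] by blast
      have Lus: "L \<inter> set (triple_verts us) = {}" "V = L \<union> set (triple_verts us)"
        using us(3) tsV by (auto simp: L_def)
      show ?thesis
      proof (rule ccontr)
        assume contra: "\<not> ?thesis"
        then have np: "\<not> packs (Suc (length us)) V" using us(1) ts(1) by simp
        have dbxy: "distinct [b, x, y]" using b \<open>x \<noteq> y\<close> by simp
        have "length us < card N" using us(1) ts(1) N(2) by simp
        then have "L = {b, x, y} \<and> (\<exists>u v w. (u, v, w) \<in> set us \<and> (pentagon b u v y w x \<or> pentagon b v u y w x))"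
          using augment[OF us(2,4) Lus(1) b(1) xyL dbxy xy(3) _ Lus(2) N(1) _ N(3,4) np] False by blast
        then obtain u v w where L3: "L = {b, x, y}" and uvw: "(u, v, w) \<in> set us"
          and pent: "pentagon b u v y w x \<or> pentagon b v u y w x" by blast
        have "card L = 3" using L3 dbxy by simp
        \<comment> \<open>Now \<open>card V = 3 * Suc k\<close>, and for \<open>k = 1\<close> this
          is the exceptional outcome. So there is a second triple \<open>(p, q, r)\<close>, and
          \<open>nine_points\<close> trades two triples and \<open>L\<close> for three
          triples.\<close>
        then have "k \<noteq> 1" using contra cL by auto
        obtain us1 us2 where split: "us = us1 @ (u, v, w) # us2" using uvw by (meson split_list)
        let ?us = "us1 @ us2"
        have "length ?us + 1 = k" using us(1) ts(1) split by simp
        then have "?us \<noteq> []" using \<open>k \<noteq> 1\<close> by auto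
        then obtain t where "t \<in> set ?us" by (meson hd_in_set)
        moreover obtain p q r where "t = (p, q, r)" by (cases t)
        ultimately have pqr: "(p, q, r) \<in> set ?us" by blast
        obtain vs1 vs2 where split2: "?us = vs1 @ (p, q, r) # vs2" using pqr by (meson split_list)
        have len: "length (vs1 @ vs2) + 2 = k" using \<open>length ?us + 1 = k\<close> split2
          by (metis add_Suc_right length_append length_Cons add.commute add_2_eq_Suc' Suc_eq_plus1)
        have tv: "distinct (u # v # w # triple_verts ?us)" "set (triple_verts us) = {u, v, w} \<union> set (triple_verts ?us)"
          using us(2) split by auto
        then have tv2: "distinct (u # v # w # p # q # r # triple_verts (vs1 @ vs2))"
          "set (triple_verts us) = {u, v, w, p, q, r} \<union> set (triple_verts (vs1 @ vs2))"
          unfolding split2 by auto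
        have oddpqr: "odd3 b p q" "odd3 p q r" using us(4)[of p q r] pqr split by auto
        have Lno: "m \<notin> set (u # v # w # p # q # r # triple_verts (vs1 @ vs2))" if "m \<in> L" for m
          using that Lus(1) tv2(2) by auto
        have bxyno: "b \<notin> set (u # v # w # p # q # r # triple_verts (vs1 @ vs2))"
          "x \<notin> set (u # v # w # p # q # r # triple_verts (vs1 @ vs2))"
          "y \<notin> set (u # v # w # p # q # r # triple_verts (vs1 @ vs2))" using Lno L3 by auto
        define U where "U = {u, v, w, p, q, r, b, x, y}"
        have "packs 3 U"
        proof -
          have "packs 3 {u, v, y, w, x, b, p, q, r} \<or> packs 3 {v, u, y, w, x, b, p, q, r}"
            using pent
          proof
            assume a: "pentagon b u v y w x"
            have "distinct [u, v, y, w, x, b, p, q, r]" using tv2(1) bxyno dbxy by auto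
            then show ?thesis using nine_points[OF a oddpqr] by blast
          next
            assume a: "pentagon b v u y w x"
            have "distinct [v, u, y, w, x, b, p, q, r]" using tv2(1) bxyno dbxy by auto
            then show ?thesis using nine_points[OF a oddpqr] by blast
          qed
          then show ?thesis by (rule disjE) (erule packs_mono, simp add: U_def)+
        qed
        then have "packs (3 + length (vs1 @ vs2)) (U \<union> set (triple_verts (vs1 @ vs2)))"
        proof (rule packs_append)
          show "distinct (triple_verts (vs1 @ vs2))" using tv2(1) by simp
          show "U \<inter> set (triple_verts (vs1 @ vs2)) = {}" using tv2(1) bxyno by (simp add: U_def)
          have "set (vs1 @ vs2) \<subseteq> set ?us" unfolding split2 by auto
          also have "set ?us \<subseteq> set us" unfolding split by auto
          finally have "t \<in> set us" if "t \<in> set (vs1 @ vs2)" for t using that by (rule subsetD)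
          then show "\<forall>(u, v, w)\<in>set (vs1 @ vs2). odd3 u v w" using us(4) by fast
        qed
        moreover have "U \<union> set (triple_verts (vs1 @ vs2)) \<subseteq> V"
          unfolding Lus(2) tv2(2) L3 U_def by blast
        ultimately have "packs (3 + length (vs1 @ vs2)) V" by (rule packs_mono)
        moreover have "3 + length (vs1 @ vs2) = Suc k" using len by simp
        ultimately have "packs (Suc k) V" by (simp only:)
        then show False using contra by blast
      qed
    qed
  qed
qed

section \<open>Models of complete minors\<close>

definition small_connected :: "'a set \<Rightarrow> bool" where
  "small_connected X \<longleftrightarrow> (\<exists>x. X = {x}) \<or> (\<exists>x y. X = {x, y} \<and> \<not> h x y) \<or> (\<exists>x y z. X = {x, y, z} \<and> odd3 x y z)"

lemma small_connectedI:
  "small_connected {x}"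
  "\<not> h x y \<Longrightarrow> small_connected {x, y}"
  "odd3 x y z \<Longrightarrow> small_connected {x, y, z}"
  unfolding small_connected_def
  by (rule disjI1, rule exI, rule refl)
    (rule disjI2, rule disjI1, rule exI, rule exI, rule conjI, rule refl, assumption,
     rule disjI2, rule disjI2, rule exI, rule exI, rule exI, rule conjI, rule refl, assumption)

text \<open>The branch sets of a complete minor of order \<open>t\<close> in the complement of
  \<open>h\<close>, limited to the shapes that the constructions produce.\<close>

definition clique_model :: "nat \<Rightarrow> 'a set \<Rightarrow> bool" where
  "clique_model t V \<longleftrightarrow> (\<exists>\<B>. card \<B> = t \<and> finite \<B> \<and> disjoint \<B> \<and> \<Union>\<B> \<subseteq> V \<and>
    (\<forall>X\<in>\<B>. small_connected X) \<and> (\<forall>X\<in>\<B>. \<forall>Y\<in>\<B>. X \<noteq> Y \<longrightarrow> (\<exists>x\<in>X. \<exists>y\<in>Y. \<not> h x y)))"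

lemma clique_modelI:
  assumes "t \<le> card \<B>" "finite \<B>" "disjoint \<B>" "\<Union>\<B> \<subseteq> V" "\<And>X. X \<in> \<B> \<Longrightarrow> small_connected X"
    "\<And>X Y. X \<in> \<B> \<Longrightarrow> Y \<in> \<B> \<Longrightarrow> X \<noteq> Y \<Longrightarrow> \<exists>x\<in>X. \<exists>y\<in>Y. \<not> h x y"
  shows "clique_model t V"
proof -
  obtain \<C> where C: "\<C> \<subseteq> \<B>" "card \<C> = t" "finite \<C>"
    using obtain_subset_with_card_n[OF assms(1)] assms(2) by (metis finite_subset)
  have "disjoint \<C>" using assms(3) C(1) by (rule pairwise_subset)
  moreover have "\<Union>\<C> \<subseteq> V" using assms(4) C(1) by blast
  ultimately show ?thesis unfolding clique_model_def
    using C assms(5,6) by (intro exI[of _ \<C>]) (simp add: subset_iff)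
qed

lemma clique_model_mono:
  assumes "clique_model t V" and "V \<subseteq> W" and "s \<le> t"
  shows "clique_model s W"
proof -
  obtain \<B> where B: "card \<B> = t" "finite \<B>" "disjoint \<B>" "\<Union>\<B> \<subseteq> V" "\<forall>X\<in>\<B>. small_connected X"
    "\<forall>X\<in>\<B>. \<forall>Y\<in>\<B>. X \<noteq> Y \<longrightarrow> (\<exists>x\<in>X. \<exists>y\<in>Y. \<not> h x y)"
    using assms(1) unfolding clique_model_def by blast
  show ?thesis
  proof (rule clique_modelI[of _ \<B>])
    show "\<Union>\<B> \<subseteq> W" using B(4) assms(2) by (rule subset_trans)
  qed (use B(1-3,5,6) assms(3) in simp_all)
qed

text \<open>A common \<open>h\<close>-neighbour of all three vertices would close a triangle with
  the \<open>h\<close>-edge of the odd triple.\<close>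

lemma odd3_dominates:
  assumes "odd3 x y z"
  shows "\<exists>u\<in>{x, y, z}. \<not> h u v"
proof (rule ccontr)
  assume "\<not> ?thesis"
  then have "h x v" "h y v" "h z v" by auto
  then have "\<not> h x y" "\<not> h y z" "\<not> h x z" using no_triangle sym by blast+
  then show False using assms by (simp add: odd3_def)
qed

text \<open>Singletons of the stable set \<open>Z\<close> are linked to each other, and by
  \<open>odd3_dominates\<close> a triple is linked to every branch set.\<close>

lemma clique_model_of_packs:
  assumes Z: "finite Z" "stable Z" "Z \<subseteq> V" and "packs k (V - Z)"
  shows "clique_model (card Z + k) V"
proof -
  obtain ts where ts: "length ts = k" "distinct (triple_verts ts)" "set (triple_verts ts) \<subseteq> V - Z"
    "\<forall>(x, y, z)\<in>set ts. odd3 x y z" using assms(4) unfolding packs_def by blast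
  let ?S = "(\<lambda>z. {z}) ` Z" and ?T = "(\<lambda>(x, y, z). {x, y, z}) ` set ts"
  note T = blocks_of_triples[OF ts(2)]
  have todd: "\<exists>x y z. X = {x, y, z} \<and> odd3 x y z" if X: "X \<in> ?T" for X
  proof -
    obtain t where t: "t \<in> set ts" "X = (\<lambda>(x, y, z). {x, y, z}) t" using X by (rule imageE)
    obtain x y z where "t = (x, y, z)" by (cases t)
    then show ?thesis using t ts(4) by (intro exI[of _ x] exI[of _ y] exI[of _ z]) auto
  qed
  have ST: "X \<inter> Y = {}" if X: "X \<in> ?S" and Y: "Y \<in> ?T" for X Y
  proof -
    have "Y \<subseteq> set (triple_verts ts)" unfolding T(3)[symmetric] using Y by (rule Union_upper)
    then have "Y \<subseteq> V - Z" using ts(3) by (rule subset_trans)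
    moreover obtain z where z: "X = {z}" "z \<in> Z" using X by (rule imageE)
    ultimately have "z \<notin> Y" by (meson DiffD2 subsetD)
    then show ?thesis using z by simp
  qed
  have ne: "X \<noteq> {}" if X: "X \<in> ?S \<union> ?T" for X
  proof (cases "X \<in> ?T")
    case True
    from todd[OF this] show ?thesis by (elim exE conjE) simp
  next
    case False
    then have "X \<in> ?S" using X by (simp only: Un_iff) simp
    then show ?thesis by (rule imageE) simp
  qed
  have dom: "\<exists>x\<in>X. \<exists>y\<in>Y. \<not> h x y" if X: "X \<in> ?T" and Y: "Y \<in> ?S \<union> ?T" for X Y
  proof -
    obtain v where "v \<in> Y" using ne[OF Y] by (meson ex_in_conv)
    moreover obtain x y z where xyz: "X = {x, y, z}" "odd3 x y z" using todd[OF X] by (elim exE conjE)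
    moreover obtain u where "u \<in> {x, y, z}" "\<not> h u v" using odd3_dominates[OF xyz(2)] by (rule bexE)
    ultimately show ?thesis by (intro bexI[of _ u] bexI[of _ v]) simp_all
  qed
  show ?thesis
  proof (rule clique_modelI[of _ "?S \<union> ?T"])
    have "card (?S \<union> ?T) = card ?S + card ?T"
    proof (rule card_Un_disjoint)
      show "?S \<inter> ?T = {}"
      proof (rule equals0I)
        fix X assume "X \<in> ?S \<inter> ?T"
        then have "X \<inter> X = {}" "X \<noteq> {}" using ST[of X X] ne[of X] by simp_all
        then show False by simp
      qed
    qed (use Z in auto)
    also have "card ?S = card Z" by (rule card_image) simp
    finally show "card Z + k \<le> card (?S \<union> ?T)" using T(2) ts(1) by simp
    show "finite (?S \<union> ?T)" using Z(1) by simp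
    show "disjoint (?S \<union> ?T)"
    proof (rule disjoint_union)
      show "disjoint ?S" by (auto simp: disjoint_def)
      show "disjoint ?T" by (rule T(1))
      show "\<Union>?S \<inter> \<Union>?T = {}" using T(3) ts(3) by auto
    qed
    show "\<Union>(?S \<union> ?T) \<subseteq> V" using T(3) ts(3) Z(3) by auto
    show "small_connected X" if X: "X \<in> ?S \<union> ?T" for X
      using X
    proof
      assume "X \<in> ?S"
      then show ?thesis by (rule imageE) (simp add: small_connectedI(1))
    next
      assume "X \<in> ?T"
      from todd[OF this] show ?thesis by (elim exE conjE) (simp add: small_connectedI(3))
    qed
    show "\<exists>x\<in>X. \<exists>y\<in>Y. \<not> h x y" if XY: "X \<in> ?S \<union> ?T" "Y \<in> ?S \<union> ?T" "X \<noteq> Y" for X Y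
    proof (cases "X \<in> ?T \<or> Y \<in> ?T")
      case True
      then show ?thesis
      proof
        assume "X \<in> ?T"
        then show ?thesis using XY(2) by (rule dom)
      next
        assume "Y \<in> ?T"
        from dom[OF this XY(1)] obtain y x where "y \<in> Y" "x \<in> X" "\<not> h y x" by (elim bexE)
        then show ?thesis using h_comm[of x y] by (intro bexI[of _ x] bexI[of _ y]) simp_all
      qed
    next
      case False
      then have "X \<in> ?S" "Y \<in> ?S" using XY(1,2) by (simp_all only: Un_iff de_Morgan_disj) simp_all
      then have "\<exists>x\<in>Z. X = {x}" "\<exists>y\<in>Z. Y = {y}" unfolding image_iff .
      then show ?thesis
      proof (elim bexE)
        fix x y assume "x \<in> Z" "X = {x}" "y \<in> Z" "Y = {y}"
        then show ?thesis using Z(2) by (simp add: stable_def)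
      qed
    qed
  qed
qed

text \<open>Take a joined pair of maximum total size. Each further vertex has no
  \<open>h\<close>-neighbour in one of its sides, so of the \<open>2 * t - 1\<close> vertices at
  least \<open>t\<close> belong to one side or are assigned to it. The singletons of this side and
  pairs of an assigned vertex with one of the other side form the model; maximality gives Hall's
  condition for the pairs.\<close>

lemma clique_model_of_joined:
  assumes fin: "finite V" and AB: "A \<subseteq> V" "B \<subseteq> V" "A \<noteq> {}" "B \<noteq> {}" "joined A B"
    and t: "card V + 1 = 2 * t" "t \<le> card A + card B"
  shows "clique_model t V"
proof -
  define \<P> where "\<P> = {(A, B). A \<subseteq> V \<and> B \<subseteq> V \<and> A \<noteq> {} \<and> B \<noteq> {} \<and> joined A B}"
  define f where "f = (\<lambda>(A :: 'a set, B :: 'a set). card A + card B)"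
  have "\<P> \<subseteq> Pow V \<times> Pow V" by (auto simp: \<P>_def)
  then have finP: "finite \<P>" using fin by (meson finite_Pow_iff finite_SigmaI finite_subset)
  have AB_P: "(A, B) \<in> \<P>" using AB by (simp add: \<P>_def)
  have "Max (f ` \<P>) \<in> f ` \<P>" using finP AB_P by (intro Max_in) auto
  then obtain P where P: "P \<in> \<P>" "Max (f ` \<P>) = f P" by blast
  have mx: "f P' \<le> f P" if "P' \<in> \<P>" for P'
    unfolding P(2)[symmetric] using that finP by (intro Max_ge) auto
  obtain A' B' where P': "P = (A', B')" by (cases P)
  have big: "t \<le> card A' + card B'" using mx[OF AB_P] t(2) P' by (simp add: f_def)
  have mx': "card C + card D \<le> card A' + card B'"
    if "C \<subseteq> V" "D \<subseteq> V" "C \<noteq> {}" "D \<noteq> {}" "joined C D" for C D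
    using mx[of "(C, D)"] that P' by (simp add: \<P>_def f_def)
  have one_side: "clique_model t V"
    if AB: "A \<subseteq> V" "B \<subseteq> V" "A \<noteq> {}" "B \<noteq> {}" "joined A B"
      and big: "t \<le> card A + card B" and mx: "card A + card B = card A' + card B'"
      and X: "X \<subseteq> V" "X \<inter> A = {}" "X \<inter> B = {}" "\<And>x a. x \<in> X \<Longrightarrow> a \<in> A \<Longrightarrow> \<not> h a x"
      and tX: "t \<le> card A + card X" for A B X
  proof -
    have finAB: "finite A" "finite B" "finite X" using AB X fin by (auto intro: finite_subset)
    \<comment> \<open>\<open>X\<close> may exceed \<open>B\<close>, so only a part of it is matched;
      \<open>tX\<close> and \<open>big\<close> ensure \<open>t\<close> branch sets whichever of the
      two is smaller.\<close>
    have "min (card X) (card B) \<le> card X" by simp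
    then obtain Y where Y: "Y \<subseteq> X" "card Y = min (card X) (card B)" "finite Y"
      using obtain_subset_with_card_n by metis
    have tY: "t \<le> card A + card Y" using tX big Y(2) by simp
    define N where "N x = {c \<in> B. \<not> h x c}" for x
    have "\<exists>g. inj_on g Y \<and> (\<forall>x\<in>Y. g x \<in> N x)"
    proof (rule hall)
      fix S assume S: "S \<subseteq> Y"
      have finS: "finite S" using S Y(3) by (rule finite_subset)
      have NB: "\<Union>(N ` S) \<subseteq> B" by (auto simp: N_def)
      let ?D = "B - \<Union>(N ` S)"
      have cD: "card ?D = card B - card (\<Union>(N ` S))"
        using NB finAB by (intro card_Diff_subset) (auto intro: finite_subset)
      show "card S \<le> card (\<Union>(N ` S))"
      proof (cases "?D = {}")
        case True
        then have "\<Union>(N ` S) = B" using NB by blast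
        moreover have "card S \<le> card Y" using S Y(3) by (intro card_mono)
        ultimately show ?thesis using Y(2) by simp
      next
        case False
        have "joined (A \<union> S) ?D" using AB(5) by (auto simp: joined_def N_def)
        then have "card (A \<union> S) + card ?D \<le> card A + card B"
          unfolding mx using False AB S Y(1) X(1) by (intro mx') auto
        moreover have "card (A \<union> S) = card A + card S"
          using S Y(1) X(2) finS finAB by (intro card_Un_disjoint) auto
        moreover have "card (\<Union>(N ` S)) \<le> card B" using NB finAB by (intro card_mono) auto
        ultimately show ?thesis using cD by linarith
      qed
    qed (use Y finAB in \<open>auto simp: N_def\<close>)
    then obtain g where g: "inj_on g Y" "\<And>x. x \<in> Y \<Longrightarrow> g x \<in> B \<and> \<not> h x (g x)"
      by (auto simp: N_def)
    have gB: "g ` Y \<subseteq> B" using g(2) by blast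
    have disjAB: "A \<inter> B = {}" by (rule joined_disjoint) (rule AB(5))
    have "g ` Y \<inter> Y = {}" using gB Y(1) X(3) by blast
    note pairs = pairs_of_injection[OF g(1) this]
    have stA: "stable A" "stable B" using joined_stable joined_sym AB by blast+
    let ?S = "(\<lambda>a. {a}) ` A" and ?T = "(\<lambda>x. {x, g x}) ` Y"
    have rep: "(\<exists>a\<in>A. Z = {a}) \<or> (\<exists>x\<in>Y. Z = {x, g x})" if "Z \<in> ?S \<union> ?T" for Z
      using that unfolding Un_iff image_iff .
    have UT: "\<Union>?T \<subseteq> Y \<union> B" using gB by auto
    have ST: "\<Union>?S \<inter> \<Union>?T = {}" using UT disjAB X(2) Y(1) by auto
    show ?thesis
    proof (rule clique_modelI[of _ "?S \<union> ?T"])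
      have "card (?S \<union> ?T) = card ?S + card ?T"
      proof (rule card_Un_disjoint)
        show "?S \<inter> ?T = {}"
        proof (rule equals0I)
          fix Z assume Z: "Z \<in> ?S \<inter> ?T"
          then obtain a where a: "a \<in> Z" by blast
          have "a \<in> \<Union>?S \<inter> \<Union>?T" by (rule IntI[OF UnionI[OF IntD1[OF Z] a] UnionI[OF IntD2[OF Z] a]])
          then show False unfolding ST by (rule emptyE)
        qed
      qed (use finAB Y in auto)
      also have "card ?S = card A" by (rule card_image) simp
      finally show "t \<le> card (?S \<union> ?T)" using pairs(2) tY by simp
      show "finite (?S \<union> ?T)" using finAB Y by simp
      show "disjoint (?S \<union> ?T)"
      proof (rule disjoint_union)
        show "disjoint ?S" by (auto simp: disjoint_def)
      qed (use pairs(1) ST in auto)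
      have "\<Union>?S \<subseteq> V" using AB(1) by auto
      moreover have "Y \<union> B \<subseteq> V" using AB(2) X(1) Y(1) by blast
      ultimately show "\<Union>(?S \<union> ?T) \<subseteq> V"
        using subset_trans[OF UT] by (simp only: Union_Un_distrib Un_subset_iff)
      show "small_connected Z" if Z: "Z \<in> ?S \<union> ?T" for Z
        using rep[OF Z]
      proof (elim disjE bexE)
        fix a assume "Z = {a}"
        then show ?thesis by (simp add: small_connectedI(1))
      next
        fix x assume "x \<in> Y" "Z = {x, g x}"
        then show ?thesis using g(2)[of x] by (simp add: small_connectedI(2))
      qed
      have AY: "\<not> h a x" "\<not> h x a" if "a \<in> A" "x \<in> Y" for a x
        using X(4)[of x a] subsetD[OF Y(1), of x] that h_comm[of a x] by simp_all
      show "\<exists>x\<in>Z. \<exists>y\<in>W. \<not> h x y" if ZW: "Z \<in> ?S \<union> ?T" "W \<in> ?S \<union> ?T" "Z \<noteq> W" for Z W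
        using rep[OF ZW(1)] rep[OF ZW(2)]
      proof (elim disjE bexE)
        fix a a' assume "a \<in> A" "a' \<in> A" "Z = {a}" "W = {a'}"
        then show ?thesis using stA(1) by (simp add: stable_def)
      next
        fix a x assume "a \<in> A" "x \<in> Y" "Z = {a}" "W = {x, g x}"
        then show ?thesis using AY[of a x] by simp
      next
        fix a x assume "a \<in> A" "x \<in> Y" "Z = {x, g x}" "W = {a}"
        then show ?thesis using AY[of a x] by simp
      next
        fix x x' assume xx: "x \<in> Y" "x' \<in> Y" "Z = {x, g x}" "W = {x', g x'}"
        then have "\<not> h (g x) (g x')" using stA(2) g(2)[of x] g(2)[of x'] by (simp add: stable_def)
        then show ?thesis using xx(3,4) by simp
      qed
    qed
  qed
  have AB': "A' \<subseteq> V" "B' \<subseteq> V" "A' \<noteq> {}" "B' \<noteq> {}" "joined A' B'"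
    using P(1) P' by (auto simp: \<P>_def)
  have finAB: "finite A'" "finite B'" using AB' fin by (auto intro: finite_subset)
  define R where "R = V - (A' \<union> B')"
  define XA where "XA = {x \<in> R. \<forall>a\<in>A'. \<not> h a x}"
  define XB where "XB = R - XA"
  have "card R = card V - card (A' \<union> B')" unfolding R_def
    using AB' finAB by (intro card_Diff_subset) auto
  moreover have "card (A' \<union> B') = card A' + card B'"
    using joined_disjoint[OF AB'(5)] finAB by (rule_tac card_Un_disjoint)
  moreover have "card (A' \<union> B') \<le> card V" using AB' fin by (intro card_mono) auto
  moreover have "card XB = card R - card XA" unfolding XB_def
    using fin by (intro card_Diff_subset) (auto simp: XA_def R_def)
  moreover have "card XA \<le> card R" using fin by (intro card_mono) (auto simp: XA_def R_def)
  ultimately have "card A' + card B' + card XA + card XB = card V" by linarith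
  then consider "t \<le> card A' + card XA" | "t \<le> card B' + card XB" using t(1) by linarith
  then show ?thesis
  proof cases
    case 1
    show ?thesis
      by (rule one_side[OF AB' big refl _ _ _ _ 1]) (auto simp: XA_def R_def)
  next
    case 2
    \<comment> \<open>A vertex outside \<open>XA\<close> has an \<open>h\<close>-neighbour
      \<open>a\<close> in \<open>A'\<close>; an \<open>h\<close>-neighbour \<open>c\<close> in
      \<open>B'\<close> would close a triangle.\<close>
    have "\<not> h c x" if x: "x \<in> XB" and c: "c \<in> B'" for x c
    proof -
      obtain a where "a \<in> A'" "h a x" using x by (auto simp: XB_def XA_def)
      moreover then have "h a c" using AB'(5) c by (simp add: joined_def)
      ultimately show ?thesis using no_triangle sym by blast
    qed
    then show ?thesis using big
      by (intro one_side[OF AB'(2,1,4,3) joined_sym[OF AB'(5)] _ _ _ _ _ _ 2])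
        (auto simp: XB_def R_def)
  qed
qed

section \<open>Degree sums and two Ramsey bounds\<close>

lemma even_degree_sum:
  assumes "finite V"
  shows "even (\<Sum>u\<in>V. card {v \<in> V. h u v})"
proof -
  let ?f = "\<lambda>u v. if h u v then 1 else 0 :: nat"
  have "even (\<Sum>u\<in>V. \<Sum>v\<in>V. ?f u v)"
    using assms
  proof (induction V rule: finite_induct)
    case (insert x F)
    have eq: "(\<Sum>u\<in>F. ?f u x) = (\<Sum>u\<in>F. ?f x u)" using h_comm by (intro sum.cong) auto
    have "(\<Sum>u\<in>insert x F. \<Sum>v\<in>insert x F. ?f u v) =
        ?f x x + (\<Sum>u\<in>F. ?f x u) + ((\<Sum>u\<in>F. ?f u x) + (\<Sum>u\<in>F. \<Sum>v\<in>F. ?f u v))"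
      by (simp only: sum.insert[OF insert.hyps] sum.distrib)
    also have "\<dots> = 2 * (\<Sum>u\<in>F. ?f x u) + (\<Sum>u\<in>F. \<Sum>v\<in>F. ?f u v)"
      unfolding eq using irrefl by simp
    finally show ?case using insert.IH by simp
  qed simp
  moreover have "card {v \<in> V. h u v} = (\<Sum>v\<in>V. ?f u v)" for u
    using assms by (simp add: sum.If_cases Int_def)
  ultimately show ?thesis by simp
qed

text \<open>The bounds \<open>R(3,3) \<le> 6\<close> and \<open>R(3,4) \<le> 9\<close>.\<close>

lemma stable3:
  assumes "finite W" "6 \<le> card W"
  shows "\<exists>Q\<subseteq>W. stable Q \<and> card Q = 3"
proof -
  obtain w where w: "w \<in> W" using assms by (metis all_not_in_conv card.empty not_numeral_le_zero)
  let ?N = "{u \<in> W. h w u}" and ?M = "{u \<in> W - {w}. \<not> h w u}"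
  have "W - {w} = ?N \<union> ?M" "?N \<inter> ?M = {}" using irrefl by auto
  then have "card (W - {w}) = card ?N + card ?M"
    using assms(1) by (metis (no_types, lifting) card_Un_disjoint finite_Diff finite_Un)
  then have "5 \<le> card ?N + card ?M" using w assms by (simp add: card_Diff_singleton)
  then consider "3 \<le> card ?N" | "3 \<le> card ?M" by linarith
  then show ?thesis
  proof cases
    case 1
    then obtain Q where Q: "Q \<subseteq> ?N" "card Q = 3" using obtain_subset_with_card_n by metis
    have "stable Q" unfolding stable_def
    proof (intro ballI)
      fix p q assume "p \<in> Q" "q \<in> Q"
      then have "h w p" "h w q" using Q(1) by auto
      then show "\<not> h p q" using no_triangle sym by blast
    qed
    then show ?thesis using Q by blast
  next
    case 2
    then obtain Q where Q: "Q \<subseteq> ?M" "card Q = 3" using obtain_subset_with_card_n by metis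
    then obtain p q r where pqr: "Q = {p, q, r}" "p \<noteq> q" "q \<noteq> r" "p \<noteq> r" by (auto simp: card_3_iff)
    have "\<exists>c\<in>Q. \<exists>d\<in>Q. c \<noteq> d \<and> \<not> h c d" using pqr no_triangle[of p q r] by auto
    then obtain c d where cd: "c \<in> Q" "d \<in> Q" "c \<noteq> d" "\<not> h c d" by blast
    have M: "c \<in> W" "d \<in> W" "c \<noteq> w" "d \<noteq> w" "\<not> h w c" "\<not> h w d" using cd Q(1) by auto
    have "stable {w, c, d}" using cd M irrefl sym by (auto simp: stable_def)
    moreover have "card {w, c, d} = 3" using cd M by auto
    ultimately show ?thesis using M w by (intro exI[of _ "{w, c, d}"]) auto
  qed
qed

lemma stable4:
  assumes fin: "finite V" and nine: "card V = 9"
  shows "\<exists>Q\<subseteq>V. stable Q \<and> card Q = 4"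
proof -
  let ?N = "\<lambda>v. {u \<in> V. h v u}"
  \<comment> \<open>A 3-regular graph on nine vertices has an odd degree sum. So some vertex has
    four neighbours, which form a stable set, or at least six non-neighbours, to which
    \<open>stable3\<close> applies.\<close>
  have "\<exists>v\<in>V. card (?N v) \<noteq> 3"
  proof (rule ccontr)
    assume "\<not> ?thesis"
    then have "(\<Sum>u\<in>V. card (?N u)) = 27" using nine by simp
    then show False using even_degree_sum[OF fin] by simp
  qed
  then obtain v where v: "v \<in> V" "card (?N v) \<noteq> 3" by blast
  then consider "4 \<le> card (?N v)" | "card (?N v) \<le> 2" by linarith
  then show ?thesis
  proof cases
    case 1
    then obtain Q where Q: "Q \<subseteq> ?N v" "card Q = 4" using obtain_subset_with_card_n by metis
    have "stable Q" unfolding stable_def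
    proof (intro ballI)
      fix p q assume "p \<in> Q" "q \<in> Q"
      then have "h v p" "h v q" using Q(1) by auto
      then show "\<not> h p q" using no_triangle sym by blast
    qed
    then show ?thesis using Q by blast
  next
    case 2
    let ?W = "V - insert v (?N v)"
    have "v \<notin> ?N v" using irrefl by simp
    then have "card (insert v (?N v)) = Suc (card (?N v))" using fin by simp
    moreover have "card ?W = card V - card (insert v (?N v))"
      using fin v(1) by (intro card_Diff_subset) auto
    ultimately have "6 \<le> card ?W" using 2 nine by simp
    then obtain Q where Q: "Q \<subseteq> ?W" "stable Q" "card Q = 3" using stable3[of ?W] fin by auto
    have "stable (insert v Q)" using Q(1,2) irrefl sym by (auto simp: stable_def)
    moreover have "card (insert v Q) = 4" using Q(1,3) by (subst card_insert_disjoint) (auto intro: card_ge_0_finite)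
    ultimately show ?thesis using Q(1) v(1) by (intro exI[of _ "insert v Q"]) auto
  qed
qed

section \<open>Models of order half the number of vertices\<close>

text \<open>With \<open>k = t - card Z\<close> and \<open>F = V - Z\<close>, the size of
  \<open>F\<close> is \<open>2 * k + card Z - 1\<close>. The lower bound on \<open>card Z\<close>
  then amounts to \<open>3 * k <= card F\<close>, and maximality of \<open>Z\<close> becomes the
  stable-set bound in \<open>packs_of_spread\<close>. If \<open>spread t V\<close> fails, there is a
  joined pair of total size at least \<open>t\<close>.\<close>

lemma clique_model_odd:
  assumes fin: "finite V" and t: "card V + 1 = 2 * t"
    and Z: "Z \<subseteq> V" "stable Z" "t + 1 \<le> 2 * card Z"
    and max: "\<And>Q. Q \<subseteq> V \<Longrightarrow> stable Q \<Longrightarrow> card Q \<le> card Z"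
  shows "clique_model t V"
proof (cases "t \<le> card Z")
  case True
  have finZ: "finite Z" using Z fin by (auto intro: finite_subset)
  show ?thesis
  proof (rule clique_modelI[of _ "(\<lambda>z. {z}) ` Z"])
    have "card ((\<lambda>z. {z}) ` Z) = card Z" by (rule card_image) simp
    then show "t \<le> card ((\<lambda>z. {z}) ` Z)" using True by simp
    show "small_connected X" if "X \<in> (\<lambda>z. {z}) ` Z" for X using that by (auto simp: small_connectedI)
    show "\<exists>x\<in>X. \<exists>y\<in>Y. \<not> h x y" if "X \<in> (\<lambda>z. {z}) ` Z" "Y \<in> (\<lambda>z. {z}) ` Z" for X Y
      using that Z(2) by (auto simp: stable_def)
  qed (use finZ Z in \<open>auto simp: disjoint_def\<close>)
next
  case False
  have finZ: "finite Z" using Z fin by (auto intro: finite_subset)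
  define k where "k = t - card Z"
  have tk: "t = card Z + k" using False by (simp add: k_def)
  define F where "F = V - Z"
  have "card F = card V - card Z" unfolding F_def using finZ Z by (intro card_Diff_subset)
  then have cF: "card F + 1 = 2 * k + card Z" using t tk by linarith
  show ?thesis
  proof (cases "spread t V")
    case False
    then obtain A B where AB: "A \<subseteq> V" "B \<subseteq> V" "A \<noteq> {}" "B \<noteq> {}" "joined A B"
      and "\<not> card A + card B + t \<le> card V" unfolding spread_def by blast
    then have "t \<le> card A + card B" using t by linarith
    then show ?thesis using clique_model_of_joined[OF fin AB t] by blast
  next
    case True
    have "packs k F \<or> (k = 2 \<and> card F = 6)"
    proof (rule packs_of_spread)
      show "finite F" using fin by (simp add: F_def)
      show "3 * k \<le> card F" using cF Z(3) tk by linarith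
      show "spread k F" unfolding spread_def
      proof (intro allI impI)
        fix A B assume "A \<subseteq> F" "B \<subseteq> F" "A \<noteq> {}" "B \<noteq> {}" "joined A B"
        then have "card A + card B + t \<le> card V"
          by (intro spreadD[OF True]) (auto simp: F_def)
        then show "card A + card B + k \<le> card F" using cF t tk by linarith
      qed
      show "card Q + 2 * k \<le> card F + 1" if "Q \<subseteq> F" "stable Q" for Q
        using max[of Q] that cF by (auto simp: F_def)
    qed
    then show ?thesis
    proof
      assume "packs k F"
      then show ?thesis using clique_model_of_packs[OF finZ Z(2,1), of k] tk by (simp add: F_def)
    next
      \<comment> \<open>Then \<open>Z\<close> has three of nine vertices, while
        \<open>stable4\<close> yields a stable set of four.\<close>
      assume k: "k = 2 \<and> card F = 6"
      then have "card Z = 3" and "card V = 9" using cF t tk by linarith+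
      moreover obtain Q where "Q \<subseteq> V" "stable Q" "card Q = 4"
        using stable4[OF fin \<open>card V = 9\<close>] by (elim exE conjE)
      ultimately show ?thesis using max[of Q] by simp
    qed
  qed
qed

theorem clique_model_half:
  assumes fin: "finite V" and Z: "Z \<subseteq> V" "stable Z" "card V + 2 \<le> 4 * card Z"
  shows "clique_model ((card V + 1) div 2) V"
proof -
  define \<S> where "\<S> = {Q. Q \<subseteq> V \<and> stable Q}"
  have "\<S> \<subseteq> Pow V" by (auto simp: \<S>_def)
  then have finS: "finite \<S>" using fin by (meson finite_Pow_iff finite_subset)
  have ZS: "Z \<in> \<S>" using Z by (simp add: \<S>_def)
  have "Max (card ` \<S>) \<in> card ` \<S>" using finS ZS by (intro Max_in) auto
  then obtain Y where Y: "Y \<in> \<S>" "Max (card ` \<S>) = card Y" by blast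
  have mx: "card Q \<le> card Y" if "Q \<in> \<S>" for Q
    unfolding Y(2)[symmetric] using that finS by (intro Max_ge) auto
  have YV: "Y \<subseteq> V" "stable Y" using Y(1) by (auto simp: \<S>_def)
  have big: "card V + 2 \<le> 4 * card Y" using mx[OF ZS] Z(3) by linarith
  show ?thesis
  proof (cases "odd (card V)")
    case True
    then obtain s where s: "card V = 2 * s + 1" by (auto elim: oddE)
    have t: "(card V + 1) div 2 = s + 1" using s by simp
    show ?thesis unfolding t
    proof (rule clique_model_odd[OF fin _ YV])
      show "card V + 1 = 2 * (s + 1)" using s by simp
      \<comment> \<open>\<open>4 * card Y >= 2 * s + 3\<close> yields
        \<open>2 * card Y >= s + 2\<close> by integrality.\<close>
      show "s + 1 + 1 \<le> 2 * card Y" using big s by linarith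
      show "card Q \<le> card Y" if "Q \<subseteq> V" "stable Q" for Q using mx that by (simp add: \<S>_def)
    qed
  next
    case False
    then obtain s where s: "card V = 2 * s" by (auto elim: evenE)
    have t: "(card V + 1) div 2 = s" using s by simp
    show ?thesis
    \<comment> \<open>For even order one vertex is deleted. It has to lie outside \<open>Y\<close>,
      so that \<open>Y\<close> remains a maximum stable set; if \<open>Y\<close> is everything,
      singletons suffice.\<close>
    proof (cases "Y = V")
      case True
      have "packs 0 (V - Y)" by (rule packsI[of "[]"]) auto
      then have "clique_model (card Y + 0) V"
        using YV fin finite_subset by (intro clique_model_of_packs) auto
      then have "clique_model (2 * s) V" using True s by simp
      then show ?thesis unfolding t by (rule clique_model_mono) simp_all
    next
      case False
      then obtain v where v: "v \<in> V" "v \<notin> Y" using YV by blast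
      define W where "W = V - {v}"
      have cW: "card W + 1 = card V"
        using v(1) fin card_gt_0_iff[of V] by (auto simp: W_def card_Diff_singleton)
      have "clique_model s W"
      proof (rule clique_model_odd[of W s Y])
        show "finite W" using fin by (simp add: W_def)
        show "card W + 1 = 2 * s" using cW s by simp
        show "Y \<subseteq> W" using YV v by (auto simp: W_def)
        show "stable Y" by (rule YV)
        show "s + 1 \<le> 2 * card Y" using big s by linarith
        show "card Q \<le> card Y" if "Q \<subseteq> W" "stable Q" for Q
          using mx[of Q] that by (auto simp: \<S>_def W_def)
      qed
      then show ?thesis unfolding t by (rule clique_model_mono) (auto simp: W_def)
    qed
  qed
qed

text \<open>Yields connectedness within two steps. Staying put counts as a step since
  \<open>h\<close> is irreflexive; only the ends of the \<open>h\<close>-edge of an odd triple need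
  its third vertex as \<open>w\<close>.\<close>

lemma small_connected_common_neighbour:
  assumes "small_connected X" "u \<in> X" "v \<in> X"
  shows "\<exists>w\<in>X. \<not> h u w \<and> \<not> h w v"
proof (cases "h u v")
  case False
  then show ?thesis using assms(2) irrefl by blast
next
  case uv: True
  then have "u \<noteq> v" using irrefl by blast
  from assms(1) show ?thesis unfolding small_connected_def
  proof (elim disjE exE conjE)
    fix x assume "X = {x}"
    then show ?thesis using assms(2,3) \<open>u \<noteq> v\<close> by simp
  next
    fix x y assume "X = {x, y}" "\<not> h x y"
    then show ?thesis using assms(2,3) uv h_comm[of x y] irrefl by auto
  next
    fix x y z assume X: "X = {x, y, z}" and o: "odd3 x y z"
    have one: "h x y \<and> \<not> h y z \<and> \<not> h x z \<or> h y z \<and> \<not> h x y \<and> \<not> h x z \<or> h x z \<and> \<not> h x y \<and> \<not> h y z"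
      using o no_triangle[of x y z] unfolding odd3_def by blast
    show ?thesis
      using one uv assms(2,3) \<open>u \<noteq> v\<close> h_comm[of x y] h_comm[of y z] h_comm[of x z] unfolding X by auto
  qed
qed

end

section \<open>Clique minors of graphs with independence number two\<close>

text \<open>The locale speaks about the whole type, and points outside \<open>verts G\<close> would
  be pairwise non-adjacent; the restriction to vertices keeps the relation triangle-free.\<close>

definition non_adjacent :: "('a, 'b) pre_digraph \<Rightarrow> 'a \<Rightarrow> 'a \<Rightarrow> bool" where
  "non_adjacent G u v \<longleftrightarrow> u \<in> verts G \<and> v \<in> verts G \<and> u \<noteq> v \<and> \<not> u \<rightarrow>\<^bsub>G\<^esub> v"

lemma triangle_free_non_adjacent:
  assumes "graph G" and ind: "\<And>S. independent_set G S \<Longrightarrow> card S \<le> 2"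
  shows "triangle_free (non_adjacent G)"
proof
  interpret graph G by fact
  show sym: "non_adjacent G y x" if "non_adjacent G x y" for x y
    using that graph_symmetric unfolding non_adjacent_def by blast
  show "\<not> non_adjacent G x x" for x by (simp add: non_adjacent_def)
  show "\<not> non_adjacent G x z" if xy: "non_adjacent G x y" and yz: "non_adjacent G y z" for x y z
  proof
    assume xz: "non_adjacent G x z"
    have "independent_set G {x, y, z}"
      using xy yz xz sym[OF xy] sym[OF yz] sym[OF xz]
      by (auto simp: independent_set_def pairwise_def non_adjacent_def)
    then have "card {x, y, z} \<le> 2" by (rule ind)
    then show False using xy yz xz by (simp add: non_adjacent_def)
  qed
qed

lemma connected_induced:
  assumes "graph G" and X: "X \<subseteq> verts G" "X \<noteq> {}"
    and common: "\<And>u v. u \<in> X \<Longrightarrow> v \<in> X \<Longrightarrow> \<exists>w\<in>X. \<not> non_adjacent G u w \<and> \<not> non_adjacent G w v"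
  shows "Digraph_Component.connected (G \<restriction> X)"
proof -
  interpret graph G by fact
  interpret H: wf_digraph "G \<restriction> X" by (rule wellformed_induce_subgraph)
  have step: "u \<rightarrow>\<^sup>*\<^bsub>G \<restriction> X\<^esub> v" if uv: "u \<in> X" "v \<in> X" "\<not> non_adjacent G u v" for u v
  proof (cases "u = v")
    case True
    then show ?thesis using uv by (simp add: H.reachable_refl)
  next
    case False
    then have "u \<rightarrow>\<^bsub>G\<^esub> v" using uv X(1) unfolding non_adjacent_def by blast
    then obtain e where "e \<in> arcs G" "tail G e = u" "head G e = v"
      by (auto simp: arcs_ends_conv)
    then have "u \<rightarrow>\<^bsub>G \<restriction> X\<^esub> v" using uv by (auto simp: arcs_ends_conv)
    then show ?thesis by (rule H.reachable_adjI)
  qed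
  show ?thesis
  proof (rule H.connectedI)
    show "verts (G \<restriction> X) \<noteq> {}" using X by simp
    fix u v assume uv: "u \<in> verts (G \<restriction> X)" "v \<in> verts (G \<restriction> X)"
    then obtain w where "w \<in> X" "\<not> non_adjacent G u w" "\<not> non_adjacent G w v" using common[of u v] by auto
    then have "u \<rightarrow>\<^sup>*\<^bsub>G \<restriction> X\<^esub> v" using uv step[of u w] step[of w v] H.reachable_trans by simp
    then show "u \<rightarrow>\<^sup>*\<^bsub>mk_symmetric (G \<restriction> X)\<^esub> v" by (rule H.reachable_mk_symmetricI)
  qed
qed

lemma clique_minor_of_model:
  assumes G: "graph G" and tf: "triangle_free (non_adjacent G)"
    and model: "triangle_free.clique_model (non_adjacent G) t (verts G)"
  shows "t \<in> clique_minor_orders G"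
proof -
  interpret graph G by fact
  interpret triangle_free "non_adjacent G" by fact
  obtain \<B> where B: "card \<B> = t" "finite \<B>" "disjoint \<B>" "\<Union>\<B> \<subseteq> verts G" "\<forall>X\<in>\<B>. small_connected X"
    "\<forall>X\<in>\<B>. \<forall>Y\<in>\<B>. X \<noteq> Y \<longrightarrow> (\<exists>x\<in>X. \<exists>y\<in>Y. \<not> non_adjacent G x y)"
    using model unfolding clique_model_def by blast
  have "card {..<t} = card \<B>" using B(1) by simp
  then obtain f where f: "bij_betw f {..<t} \<B>"
    using B(2) finite_same_card_bij[of "{..<t}" \<B>] by blast
  have fB: "f i \<in> \<B>" if "i < t" for i using f that by (auto simp: bij_betw_def)
  have fV: "f i \<subseteq> verts G" if "i < t" for i using fB[OF that] B(4) by blast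
  have fdisj: "f i \<inter> f j = {}" and fneq: "f i \<noteq> f j" if ij: "i < t" "j < t" "i \<noteq> j" for i j
  proof -
    show "f i \<noteq> f j" using f ij by (auto simp: bij_betw_def inj_on_def)
    then show "f i \<inter> f j = {}" using B(3) fB ij unfolding disjoint_def by blast
  qed
  \<comment> \<open>\<open>clique_minor_orders\<close> asks for vertices of type \<open>nat\<close>,
    so the branch sets are numbered by \<open>f\<close>.\<close>
  let ?K = "with_proj \<lparr>pverts = {..<t}, parcs = {(i, j). (i, j) \<in> {..<t} \<times> {..<t} \<and> i \<noteq> j}\<rparr>"
  have "K\<^bsub>t\<^esub> ?K" by (simp add: complete_digraph_pair_def)
  moreover have "minor ?K G" unfolding minor_def
  proof (intro exI[of _ f] conjI ballI allI impI)
    fix i assume "i \<in> verts ?K"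
    then have i: "i < t" by simp
    show "f i \<subseteq> verts G" by (rule fV[OF i])
    have sc: "small_connected (f i)" using B(5) fB[OF i] by blast
    show "Digraph_Component.connected (G \<restriction> f i)"
    proof (rule connected_induced[OF G fV[OF i]])
      show "f i \<noteq> {}" using sc by (auto simp: small_connected_def)
      show "\<exists>w\<in>f i. \<not> non_adjacent G u w \<and> \<not> non_adjacent G w v" if "u \<in> f i" "v \<in> f i" for u v
        using small_connected_common_neighbour[OF sc that] .
    qed
  next
    show "disjoint_family_on f (verts ?K)" using fdisj by (simp add: disjoint_family_on_def)
  next
    fix i j assume "i \<rightarrow>\<^bsub>?K\<^esub> j"
    then have ij: "i < t" "j < t" "i \<noteq> j" by auto
    then obtain x y where xy: "x \<in> f i" "y \<in> f j" "\<not> non_adjacent G x y"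
      using B(6) fB fneq[OF ij] by meson
    moreover have "x \<noteq> y" using xy fdisj[OF ij] by blast
    moreover have "x \<in> verts G" "y \<in> verts G" using xy fV ij by blast+
    ultimately have "x \<rightarrow>\<^bsub>G\<^esub> y" by (simp add: non_adjacent_def)
    then show "\<exists>u\<in>f i. \<exists>v\<in>f j. u \<rightarrow>\<^bsub>G\<^esub> v" using xy by blast
  qed
  ultimately show ?thesis unfolding clique_minor_orders_def by blast
qed

theorem had_ge_half:
  assumes G: "graph G" and ind: "\<And>S. independent_set G S \<Longrightarrow> card S \<le> 2"
    and Q: "clique G Q" "card (verts G) + 2 \<le> 4 * card Q"
  shows "real (card (verts G)) / 2 \<le> real (had G)"
proof -
  interpret graph G by fact
  have tf: "triangle_free (non_adjacent G)" by (rule triangle_free_non_adjacent[OF G ind])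
  interpret triangle_free "non_adjacent G" by (rule tf)
  have "stable Q" using Q(1) by (auto simp: stable_def clique_def non_adjacent_def pairwise_def)
  then have "clique_model ((card (verts G) + 1) div 2) (verts G)"
    using Q by (intro clique_model_half) (auto simp: clique_def)
  then have "(card (verts G) + 1) div 2 \<in> clique_minor_orders G"
    by (rule clique_minor_of_model[OF G tf])
  then have "(card (verts G) + 1) div 2 \<le> had G"
    unfolding had_def by (rule Max_ge[OF clique_minor_orders(1)[OF G]])
  then have "card (verts G) \<le> 2 * had G" by linarith
  then show ?thesis by linarith
qed

section \<open>Inflations\<close>

text \<open>An independent set meets each clique \<open>C x\<close> at most once, so sending its
  vertices to their \<open>x\<close> is injective.\<close>

lemma inflation_independent_set:
  assumes C: "verts G' = (\<Union>x\<in>verts G. C x)"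
    "\<And>x. x \<in> verts G \<Longrightarrow> clique G' (C x)"
    "\<And>x y u v. x \<in> verts G \<Longrightarrow> y \<in> verts G \<Longrightarrow> x \<noteq> y \<Longrightarrow> u \<in> C x \<Longrightarrow> v \<in> C y \<Longrightarrow>
      u \<rightarrow>\<^bsub>G'\<^esub> v \<longleftrightarrow> x \<rightarrow>\<^bsub>G\<^esub> y"
    and S: "independent_set G' S"
  shows "\<exists>R. independent_set G R \<and> card R = card S"
proof -
  have SV: "S \<subseteq> verts G'" and Sno: "\<And>u v. u \<in> S \<Longrightarrow> v \<in> S \<Longrightarrow> u \<noteq> v \<Longrightarrow> \<not> u \<rightarrow>\<^bsub>G'\<^esub> v"
    using S by (auto simp: independent_set_def pairwise_def)
  have "\<forall>u\<in>S. \<exists>x. x \<in> verts G \<and> u \<in> C x" using SV C(1) by blast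
  then obtain p where p: "\<And>u. u \<in> S \<Longrightarrow> p u \<in> verts G \<and> u \<in> C (p u)" by metis
  have inj: "inj_on p S"
  proof (rule inj_onI, rule ccontr)
    fix u v assume uv: "u \<in> S" "v \<in> S" "p u = p v" "u \<noteq> v"
    then have "u \<in> C (p u)" "v \<in> C (p u)" "p u \<in> verts G" using p[of u] p[of v] by simp_all
    then have "u \<rightarrow>\<^bsub>G'\<^esub> v" using C(2)[of "p u"] uv(4) by (simp add: clique_def pairwise_def)
    then show False using Sno uv by blast
  qed
  have "independent_set G (p ` S)" unfolding independent_set_def pairwise_def
  proof (intro conjI ballI impI)
    show "p ` S \<subseteq> verts G" using p by blast
    fix x y assume "x \<in> p ` S" "y \<in> p ` S" "x \<noteq> y"
    then obtain u v where uv: "u \<in> S" "v \<in> S" "x = p u" "y = p v" "u \<noteq> v" by blast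
    then have "\<not> u \<rightarrow>\<^bsub>G'\<^esub> v" using Sno by blast
    then show "\<not> x \<rightarrow>\<^bsub>G\<^esub> y" using C(3)[of x y u v] p[OF uv(1)] p[OF uv(2)] uv \<open>x \<noteq> y\<close> by simp
  qed
  then show ?thesis using card_image[OF inj] by blast
qed

lemma inflation_clique:
  assumes C: "verts G' = (\<Union>x\<in>verts G. C x)"
    "\<And>x. x \<in> verts G \<Longrightarrow> clique G' (C x)"
    "\<And>x y u v. x \<in> verts G \<Longrightarrow> y \<in> verts G \<Longrightarrow> x \<noteq> y \<Longrightarrow> u \<in> C x \<Longrightarrow> v \<in> C y \<Longrightarrow>
      u \<rightarrow>\<^bsub>G'\<^esub> v \<longleftrightarrow> x \<rightarrow>\<^bsub>G\<^esub> y"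
    and Q: "clique G Q"
  shows "clique G' (\<Union>x\<in>Q. C x)"
  unfolding clique_def pairwise_def
proof (intro conjI ballI impI)
  have QV: "Q \<subseteq> verts G" using Q by (simp add: clique_def)
  show "(\<Union>x\<in>Q. C x) \<subseteq> verts G'" unfolding C(1) using QV by blast
  fix u v assume "u \<in> (\<Union>x\<in>Q. C x)" "v \<in> (\<Union>x\<in>Q. C x)" "u \<noteq> v"
  then obtain x y where xy: "x \<in> Q" "y \<in> Q" "u \<in> C x" "v \<in> C y" by blast
  then have V: "x \<in> verts G" "y \<in> verts G" using QV by blast+
  show "u \<rightarrow>\<^bsub>G'\<^esub> v"
  proof (cases "x = y")
    case True
    then show ?thesis using C(2)[OF V(1)] xy \<open>u \<noteq> v\<close> by (simp add: clique_def pairwise_def)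
  next
    case False
    then have "x \<rightarrow>\<^bsub>G\<^esub> y" using Q xy by (simp add: clique_def pairwise_def)
    then show ?thesis using C(3)[OF V False xy(3,4)] by simp
  qed
qed

text \<open>Inflating preserves an excess in the total size of the four cliques, because
  \<open>(c - 1) * (m - 1) \<ge> 0\<close> for a vertex of weight \<open>c\<close> that lies in \<open>m\<close> of them.\<close>

lemma weighted_cover_excess:
  fixes c :: "'a \<Rightarrow> nat"
  assumes "finite V" and cover: "Q1 \<union> Q2 \<union> Q3 \<union> Q4 = V" and c: "\<And>x. x \<in> V \<Longrightarrow> 1 \<le> c x"
    and excess: "card V + d \<le> card Q1 + card Q2 + card Q3 + card Q4"
  shows "sum c V + d \<le> sum c Q1 + sum c Q2 + sum c Q3 + sum c Q4"
proof -
  define m where "m x = (of_bool (x \<in> Q1) + of_bool (x \<in> Q2) + of_bool (x \<in> Q3) + of_bool (x \<in> Q4) :: nat)" for x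
  have Qsub: "Q1 \<subseteq> V" "Q2 \<subseteq> V" "Q3 \<subseteq> V" "Q4 \<subseteq> V" using cover by auto
  have ind: "(\<Sum>x\<in>V. g x * of_bool (x \<in> Q)) = sum g Q" if "Q \<subseteq> V" for g :: "'a \<Rightarrow> nat" and Q
  proof -
    have "(\<Sum>x\<in>V. g x * of_bool (x \<in> Q)) = (\<Sum>x\<in>Q. g x * of_bool (x \<in> Q))"
      using assms(1) that by (intro sum.mono_neutral_right) auto
    then show ?thesis by simp
  qed
  have total: "(\<Sum>x\<in>V. g x * m x) = sum g Q1 + sum g Q2 + sum g Q3 + sum g Q4" for g :: "'a \<Rightarrow> nat"
    unfolding m_def by (simp only: distrib_left sum.distrib ind[OF Qsub(1)] ind[OF Qsub(2)] ind[OF Qsub(3)] ind[OF Qsub(4)])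
  have "(\<Sum>x\<in>V. c x + m x) \<le> (\<Sum>x\<in>V. c x * m x + 1)"
  proof (rule sum_mono)
    fix x assume x: "x \<in> V"
    have "1 \<le> m x" using x cover by (auto simp: m_def)
    then obtain m' where m': "m x = Suc m'" by (cases "m x") auto
    obtain c' where "c x = Suc c'" using c[OF x] by (cases "c x") auto
    then show "c x + m x \<le> c x * m x + 1" using m' by simp
  qed
  \<comment> \<open>The sum of \<open>m\<close> is the total size of the four cliques, at least
    \<open>card V + d\<close>, so \<open>card V\<close> cancels.\<close>
  then have "sum c V + (\<Sum>x\<in>V. 1 * m x) \<le> (\<Sum>x\<in>V. c x * m x) + card V"
    by (simp only: sum.distrib card_eq_sum mult_1)
  then show ?thesis unfolding total using excess by (simp only: card_eq_sum[symmetric])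
qed

theorem theorem2p32:
  fixes G :: "('a, 'b) pre_digraph" and G' :: "('c, 'd) pre_digraph"
    and Q1 Q2 Q3 Q4 :: "'a set"
  assumes "graph G" and "independence_number G = 2"
    and "clique G Q1" and "clique G Q2" and "clique G Q3" and "clique G Q4"
    and "Q1 \<union> Q2 \<union> Q3 \<union> Q4 = verts G"
    and "card Q1 + card Q2 + card Q3 + card Q4 \<ge> card (verts G) + 2"
    and "graph G'" and "proper_inflation G G'"
  shows "real (had G') \<ge> real (card (verts G')) / 2"
proof -
  interpret graph G by fact
  obtain c where c: "\<And>x. x \<in> verts G \<Longrightarrow> 1 \<le> c x" and infl: "inflation G c G'"
    using assms(10) unfolding proper_inflation_def by blast
  obtain C where C: "verts G' = (\<Union>x\<in>verts G. C x)" "disjoint_family_on C (verts G)"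
    "\<forall>x\<in>verts G. finite (C x) \<and> card (C x) = c x \<and> clique G' (C x)"
    "\<forall>x\<in>verts G. \<forall>y\<in>verts G. x \<noteq> y \<longrightarrow> (\<forall>u\<in>C x. \<forall>v\<in>C y. u \<rightarrow>\<^bsub>G'\<^esub> v \<longleftrightarrow> x \<rightarrow>\<^bsub>G\<^esub> y)"
    using infl unfolding inflation_def by (elim exE conjE)
  have Ccl: "clique G' (C x)" if "x \<in> verts G" for x using C(3) that by blast
  have Cadj: "u \<rightarrow>\<^bsub>G'\<^esub> v \<longleftrightarrow> x \<rightarrow>\<^bsub>G\<^esub> y"
    if "x \<in> verts G" "y \<in> verts G" "x \<noteq> y" "u \<in> C x" "v \<in> C y" for x y u v
    using C(4) that by blast
  have ind: "card S \<le> 2" if S: "independent_set G' S" for S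
  proof -
    obtain R where R: "independent_set G R" "card R = card S"
      using inflation_independent_set[OF C(1) Ccl Cadj S] by blast
    have "card R \<le> Max (card ` {S. independent_set G S})"
      using R(1) by (intro Max_ge independent_set_card(1)[OF assms(1)]) simp
    then show ?thesis using R(2) assms(2) by (simp add: independence_number_def)
  qed
  let ?B = "\<lambda>Q. \<Union>x\<in>Q. C x"
  have cardB: "card (?B Q) = sum c Q" if Q: "Q \<subseteq> verts G" for Q
  proof -
    have "card (?B Q) = (\<Sum>x\<in>Q. card (C x))"
    proof (rule card_UN_disjoint)
      show "finite Q" using Q finite_verts by (rule finite_subset)
      show "\<forall>x\<in>Q. finite (C x)" using C(3) Q by blast
      show "\<forall>x\<in>Q. \<forall>y\<in>Q. x \<noteq> y \<longrightarrow> C x \<inter> C y = {}"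
        using C(2) Q unfolding disjoint_family_on_def by blast
    qed
    also have "\<dots> = sum c Q" using C(3) Q by (intro sum.cong) auto
    finally show ?thesis .
  qed
  have Qsub: "Q1 \<subseteq> verts G" "Q2 \<subseteq> verts G" "Q3 \<subseteq> verts G" "Q4 \<subseteq> verts G" using assms(7) by auto
  have "sum c (verts G) + 2 \<le> sum c Q1 + sum c Q2 + sum c Q3 + sum c Q4"
    by (rule weighted_cover_excess[OF finite_verts assms(7) c assms(8)])
  then have "card (verts G') + 2 \<le> card (?B Q1) + card (?B Q2) + card (?B Q3) + card (?B Q4)"
    unfolding C(1) cardB[OF order_refl] cardB[OF Qsub(1)] cardB[OF Qsub(2)] cardB[OF Qsub(3)] cardB[OF Qsub(4)] .
  \<comment> \<open>By averaging, one of the four blow-ups has at least a quarter of the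
    total.\<close>
  then consider "card (verts G') + 2 \<le> 4 * card (?B Q1)" | "card (verts G') + 2 \<le> 4 * card (?B Q2)"
    | "card (verts G') + 2 \<le> 4 * card (?B Q3)" | "card (verts G') + 2 \<le> 4 * card (?B Q4)"
    by linarith
  then obtain Q where "clique G Q" "card (verts G') + 2 \<le> 4 * card (?B Q)"
    using assms(3-6) by cases blast+
  then show ?thesis
    using had_ge_half[OF assms(9) ind inflation_clique[OF C(1) Ccl Cadj]] by blast
qed

end
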